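(* Let $(T(s))_{s\ge0}$ be a $C_0$-semigroup on a UMD Banach space $X$, let $0<a<b$, and let $g\in\mathrm{BV}[b-a,b+a]$ be such that $g(\cdot+b)$ is even. Then the principal value integral $$\lim_{\epsilon\searrow0}\int_{\epsilon a\le|s-b|\le a}g(s)T(s)x\,\frac{\mathrm{d}s}{s-b}$$ converges for every $x\in X$.
   Context: Banach spaces are complex. A $C_0$-semigroup is a strongly continuous one-parameter operator semigroup (no boundedness assumption). A Banach space $X$ is UMD iff $t\mapsto\operatorname{sgn}t$ is a bounded Fourier multiplier on $L^2(\mathbb{R};X)$. $\mathrm{BV}[b-a,b+a]$ is the space of scalar functions of bounded variation on $[b-a,b+a]$; evenness of $g(\cdot+b)$ means $g(b+t)=g(b-t)$ for $|t|\le a$. Convergence is in the norm of $X$. *)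

theory Defs
  imports "HOL-Analysis.Analysis"
begin

(* The library has only real Banach spaces; the complex scalar action extends the real one. *)
class complex_banach = banach +
  fixes scaleC :: "complex \<Rightarrow> 'a \<Rightarrow> 'a" (infixr \<open>*\<^sub>C\<close> 75)
  assumes scaleC_add_right: "c *\<^sub>C (x + y) = c *\<^sub>C x + c *\<^sub>C y"
    and scaleC_add_left: "(c + d) *\<^sub>C x = c *\<^sub>C x + d *\<^sub>C x"
    and scaleC_scaleC: "c *\<^sub>C d *\<^sub>C x = (c * d) *\<^sub>C x"
    and scaleC_one: "1 *\<^sub>C x = x"
    and scaleC_of_real: "complex_of_real r *\<^sub>C x = r *\<^sub>R x"
    and norm_scaleC: "norm (c *\<^sub>C x) = cmod c * norm x"

definition bounded_clinear :: "('a::complex_banach \<Rightarrow> 'b::complex_banach) \<Rightarrow> bool" where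
  "bounded_clinear f \<longleftrightarrow> bounded_linear f \<and> (\<forall>c x. f (c *\<^sub>C x) = c *\<^sub>C f x)"

(* Only the values T s with s \<ge> 0 are meaningful. *)
definition C0_semigroup :: "(real \<Rightarrow> 'a::complex_banach \<Rightarrow> 'a) \<Rightarrow> bool" where
  "C0_semigroup T \<longleftrightarrow>
     (\<forall>s\<ge>0. bounded_clinear (T s)) \<and>
     (\<forall>x. T 0 x = x) \<and>
     (\<forall>s\<ge>0. \<forall>t\<ge>0. \<forall>x. T (s + t) x = T s (T t x)) \<and>
     (\<forall>x. continuous_on {0..} (\<lambda>s. T s x))"

definition BV_on :: "real \<Rightarrow> real \<Rightarrow> (real \<Rightarrow> complex) \<Rightarrow> bool" where
  "BV_on c d g \<longleftrightarrow>
     (\<exists>M. \<forall>n (t :: nat \<Rightarrow> real). mono_on {..n} t \<and> t ` {..n} \<subseteq> {c..d} \<longrightarrow>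
        (\<Sum>i<n. cmod (g (t (Suc i)) - g (t i))) \<le> M)"

(* The Schwartz class S(R;X); D n is the n-th derivative of f. *)
definition schwartz :: "(real \<Rightarrow> 'a::complex_banach) \<Rightarrow> bool" where
  "schwartz f \<longleftrightarrow>
     (\<exists>D :: nat \<Rightarrow> real \<Rightarrow> 'a. D 0 = f \<and>
        (\<forall>n t. (D n has_vector_derivative D (Suc n) t) (at t)) \<and>
        (\<forall>n k. bounded (range (\<lambda>t. t ^ k *\<^sub>R D n t))))"

(* Vector-valued integrals are Henstock-Kurzweil integrals: the library's Bochner integral is
   restricted to second countable spaces, and the two integrals agree on Bochner integrable
   functions. *)
definition fourier :: "(real \<Rightarrow> 'a::complex_banach) \<Rightarrow> real \<Rightarrow> 'a" where
  "fourier f \<xi> = integral UNIV (\<lambda>t. cis (- (2 * pi * t * \<xi>)) *\<^sub>C f t)"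

definition inv_fourier :: "(real \<Rightarrow> 'a::complex_banach) \<Rightarrow> real \<Rightarrow> 'a" where
  "inv_fourier h t = integral UNIV (\<lambda>\<xi>. cis (2 * pi * t * \<xi>) *\<^sub>C h \<xi>)"

(* m is in L-infinity and the operator sending f to the inverse transform of m times the
   transform of f, defined on the dense subspace S(R;X) of L^2(R;X), is bounded for the L^2 norm.
   For f in S(R;X) its transform is integrable, so T_m f is a bounded continuous function. *)
definition bounded_L2_fourier_multiplier ::
    "'a::complex_banach itself \<Rightarrow> (real \<Rightarrow> complex) \<Rightarrow> bool" where
  "bounded_L2_fourier_multiplier X m \<longleftrightarrow>
     m \<in> borel_measurable lebesgue \<and> bounded (range m) \<and>
     (\<exists>C::real. \<forall>f :: real \<Rightarrow> 'a. schwartz f \<longrightarrow>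
        (\<integral>\<^sup>+t. ennreal ((norm (inv_fourier (\<lambda>\<xi>. m \<xi> *\<^sub>C fourier f \<xi>) t))\<^sup>2) \<partial>lborel)
          \<le> ennreal (C\<^sup>2) * (\<integral>\<^sup>+t. ennreal ((norm (f t))\<^sup>2) \<partial>lborel))"

definition UMD :: "'a::complex_banach itself \<Rightarrow> bool" where
  "UMD X \<longleftrightarrow> bounded_L2_fourier_multiplier X (\<lambda>t. complex_of_real (sgn t))"

end

theory Submission
  imports Defs "HOL-Probability.Characteristic_Functions" "HOL-Computational_Algebra.Polynomial"
begin

text \<open>
  Smooth the orbit \<open>F(u) = T(u)x\<close>, \<open>u \<in> [0,c]\<close>, \<open>c = a + b\<close>, by a Gaussian of width \<open>r\<close>. The result is a
  Schwartz function with an explicit transform, and the multiplier \<open>sgn\<close> turns it into the convolution of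
  \<open>F\<close> with an explicit scalar kernel, Dawson's function at scale \<open>r\<close>. That kernel differs from the
  truncated Hilbert kernel \<open>1\<^bsub>|s|\<ge>r\<^esub>/s\<close> by \<open>O(r/(r\<^sup>2+s\<^sup>2))\<close>, whose \<open>L\<^sup>1\<close> norm does not depend on \<open>r\<close>.
  So UMD gives bounds uniform in \<open>r\<close> for truncated Hilbert transforms of orbits.

  The semigroup law transfers these bounds to
  \<open>\<integral>\<^bsub>r\<^esub>\<^bsup>a\<^esup> (T(b+v)x - T(b-v)x) dv/v\<close>, and summation by parts against the variation of \<open>g\<close> inserts
  the weight. The truncated integrals of the theorem are therefore uniformly bounded operators of \<open>x\<close>; on the
  dense set of vectors with Lipschitz orbits they converge, because evenness of \<open>g\<close> cancels the
  singularity. Hence they converge for every \<open>x\<close>.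
\<close>

text \<open>\<open>UMD\<close> tests the multiplier on Schwartz functions only, while an orbit cut
  off to [0,c] in general jumps at both ends; hence the smoothing. A Gaussian is used because its
  transform is again a Gaussian, so that every kernel is an explicit scalar integral and
  \<open>F\<close> enters only through an exchange of two integrals. All these exchanges rest on one
  majorant, B/(1 + (rho x)^2), whose arctan primitive gives explicit tails. The obstacle is that an
  L^2 bound says nothing about a single point, whereas the theorem concerns the one centre b. The
  way out is an estimate from b to every other centre p in [a,b]: a large truncated integral at b
  forces large ones at all these p, hence a large L^2 norm. The assumption a < b gives these centres
  positive measure; p must not fall below a, since times p - v with v up to a occur, and c = a + b
  is the largest time that occurs. Normalisation: the inverse transform of sgn is i/(pi s). It
  appears here as 2i times a kernel that behaves like 1/(2 pi s), which is why the factors 2 pi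
  accompany \<open>dawson\<close> throughout.\<close>

lemma bounded_bilinear_scaleC:
  "bounded_bilinear (scaleC :: complex \<Rightarrow> 'a \<Rightarrow> 'a::complex_banach)"
proof
  fix c d :: complex and x y :: 'a and r :: real
  show "(c + d) *\<^sub>C x = c *\<^sub>C x + d *\<^sub>C x" by (rule scaleC_add_left)
  show "c *\<^sub>C (x + y) = c *\<^sub>C x + c *\<^sub>C y" by (rule scaleC_add_right)
  show "(r *\<^sub>R c) *\<^sub>C x = r *\<^sub>R c *\<^sub>C x"
    by (simp add: scaleC_of_real[symmetric] scaleC_scaleC scaleR_conv_of_real)
  show "c *\<^sub>C r *\<^sub>R x = r *\<^sub>R c *\<^sub>C x"
    by (simp add: scaleC_of_real[symmetric] scaleC_scaleC mult.commute)
  show "\<exists>K. \<forall>a (b::'a). norm (a *\<^sub>C b) \<le> norm a * norm b * K"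
    by (rule exI[of _ 1]) (simp add: norm_scaleC)
qed

interpretation scaleC: bounded_bilinear "scaleC :: complex \<Rightarrow> 'a \<Rightarrow> 'a::complex_banach"
  by (rule bounded_bilinear_scaleC)

lemmas continuous_on_scaleC [continuous_intros] =
  bounded_bilinear.continuous_on[OF bounded_bilinear_scaleC]

lemma integral_scaleC_right:
  fixes f :: "'n::euclidean_space \<Rightarrow> 'a::complex_banach"
  assumes "f integrable_on S"
  shows "integral S (\<lambda>x. c *\<^sub>C f x) = c *\<^sub>C integral S f"
  using integral_linear[OF assms scaleC.bounded_linear_right[of c]] by (simp add: o_def)

section \<open>Improper integrals with values in a Banach space\<close>

text \<open>A box containing a large ball meets the half-line in some [0,b] with b large, so the
  condition at infinity in the definition of the integral is just convergence of the integrals over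
  [0,N].\<close>

lemma has_integral_atLeast_0:
  fixes f :: "real \<Rightarrow> 'b::banach"
  assumes int: "\<And>N. 0 \<le> N \<Longrightarrow> f integrable_on {0..N}"
    and lim: "((\<lambda>N. integral {0..N} f) \<longlongrightarrow> I) at_top"
  shows "(f has_integral I) {0..}"
  unfolding has_integral_alt'
proof (intro conjI allI impI)
  have int0: "f integrable_on {0..N}" for N
    using int[of N] by (cases "0 \<le> N") auto
  have restr: "((\<lambda>x. if x \<in> {0..} then f x else 0) has_integral integral {max 0 a..b} f) (cbox a b)"
    for a b
  proof -
    have "f integrable_on {max 0 a..b}"
      using integrable_subinterval_real[OF int0[of b], of "max 0 a" b] by simp
    then have "(f has_integral integral {max 0 a..b} f) {max 0 a..b}"
      by (rule integrable_integral)
    moreover have "{0..} \<inter> cbox a b = {max 0 a..b}" by auto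
    ultimately show ?thesis
      by (metis has_integral_restrict_Int)
  qed
  show "(\<lambda>x. if x \<in> {0..} then f x else 0) integrable_on cbox a b" for a b
    using restr by (rule has_integral_integrable)
  fix e :: real assume "e > 0"
  with lim have "\<forall>\<^sub>F N in at_top. dist (integral {0..N} f) I < e"
    by (rule tendstoD)
  then obtain B where B: "\<And>N. N \<ge> B \<Longrightarrow> dist (integral {0..N} f) I < e"
    by (auto simp: eventually_at_top_linorder)
  show "\<exists>B>0. \<forall>a b. ball 0 B \<subseteq> cbox a b \<longrightarrow>
      norm (integral (cbox a b) (\<lambda>x. if x \<in> {0..} then f x else 0) - I) < e"
  proof (intro exI[of _ "max 1 B"] conjI allI impI)
    fix a b :: real assume *: "ball 0 (max 1 B) \<subseteq> cbox a b"
    have "ball 0 (max 1 B) = {- max 1 B <..< max 1 B}"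
      by (auto simp: dist_real_def)
    then have "{- max 1 B <..< max 1 B} \<subseteq> {a..b}" using * by simp
    then have "a \<le> - max 1 B \<and> max 1 B \<le> b"
      by (subst (asm) greaterThanLessThan_subseteq_atLeastAtMost_iff) auto
    then have "max 0 a = 0" "b \<ge> B" by auto
    then show "norm (integral (cbox a b) (\<lambda>x. if x \<in> {0..} then f x else 0) - I) < e"
      using B[of b] integral_unique[OF restr[of a b]] by (simp add: dist_norm)
  qed auto
qed

section \<open>Domination by a function with arctan primitive\<close>

lemma arctan_scaled_has_integral:
  fixes \<rho> B :: real
  assumes "0 < \<rho>" "a \<le> b"
  shows "((\<lambda>x. B / (1 + (\<rho> * x)\<^sup>2)) has_integral B / \<rho> * (arctan (\<rho> * b) - arctan (\<rho> * a))) {a..b}"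
proof -
  have "((\<lambda>x. B / (1 + (\<rho> * x)\<^sup>2)) has_integral
      B / \<rho> * arctan (\<rho> * b) - B / \<rho> * arctan (\<rho> * a)) {a..b}"
  proof (rule fundamental_theorem_of_calculus[OF assms(2)])
    fix x
    have "((\<lambda>x. B / \<rho> * arctan (\<rho> * x)) has_real_derivative
       B / \<rho> * (inverse (1 + (\<rho> * x)\<^sup>2) * \<rho>)) (at x within {a..b})"
      by (auto intro!: derivative_eq_intros)
    moreover have "B / \<rho> * (inverse (1 + (\<rho> * x)\<^sup>2) * \<rho>) = B / (1 + (\<rho> * x)\<^sup>2)"
      using assms by (simp add: field_simps)
    ultimately show "((\<lambda>x. B / \<rho> * arctan (\<rho> * x)) has_vector_derivative
       B / (1 + (\<rho> * x)\<^sup>2)) (at x within {a..b})"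
      by (simp add: has_real_derivative_iff_has_vector_derivative)
  qed
  then show ?thesis by (simp add: right_diff_distrib)
qed

lemma arctan_tail_tendsto_0:
  fixes \<rho> B :: real
  assumes "0 < \<rho>"
  shows "((\<lambda>N. B / \<rho> * (pi / 2 - arctan (\<rho> * N))) \<longlongrightarrow> 0) at_top"
proof -
  have "((\<lambda>N. B / \<rho> * (pi / 2 - arctan (\<rho> * N))) \<longlongrightarrow> B / \<rho> * (pi / 2 - pi / 2)) at_top"
    using assms by (intro tendsto_intros filterlim_compose[OF tendsto_arctan_at_top]
        filterlim_tendsto_pos_mult_at_top[OF tendsto_const _ filterlim_ident])
  then show ?thesis by simp
qed

text \<open>The majorant has primitive (B/rho) arctan(rho x), which bounds the tail beyond N
  explicitly. The rate depends on \<open>f\<close> only through \<open>B\<close> and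
  \<open>\<rho>\<close>, hence is uniform in any further parameter; the norm bound is its case N =
  0.\<close>

lemma improper_integral_dominated:
  fixes f :: "real \<Rightarrow> 'b::banach"
  assumes \<rho>: "0 < \<rho>"
    and int: "\<And>N. 0 \<le> N \<Longrightarrow> f integrable_on {0..N}"
    and le: "\<And>x. 0 \<le> x \<Longrightarrow> norm (f x) \<le> B / (1 + (\<rho> * x)\<^sup>2)"
  shows "(f has_integral integral {0..} f) {0..}"
    and "\<And>N. 0 \<le> N \<Longrightarrow>
      norm (integral {0..N} f - integral {0..} f) \<le> B / \<rho> * (pi / 2 - arctan (\<rho> * N))"
    and "norm (integral {0..} f) \<le> B * pi / (2 * \<rho>)"
    and "((\<lambda>N. integral {0..N} f) \<longlongrightarrow> integral {0..} f) at_top"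
proof -
  have int': "f integrable_on {a..b}" if "0 \<le> a" for a b
    using integrable_subinterval_real[OF int[of b]] int[of b] that by (cases "0 \<le> b") auto
  have B: "0 \<le> B" using order_trans[OF norm_ge_zero le[of 0]] by simp
  have diff: "norm (integral {0..M} f - integral {0..N} f)
      \<le> B / \<rho> * (arctan (\<rho> * M) - arctan (\<rho> * N))" if "0 \<le> N" "N \<le> M" for N M
  proof -
    have "integral {0..N} f + integral {N..M} f = integral {0..M} f"
      using that by (intro Henstock_Kurzweil_Integration.integral_combine int') auto
    then have "norm (integral {0..M} f - integral {0..N} f) = norm (integral {N..M} f)"
      by (metis add_diff_cancel_left')
    also have "\<dots> \<le> integral {N..M} (\<lambda>x. B / (1 + (\<rho> * x)\<^sup>2))"
      using that \<rho> arctan_scaled_has_integral[OF \<rho> that(2), of B]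
      by (intro integral_norm_bound_integral int' le) auto
    also have "\<dots> = B / \<rho> * (arctan (\<rho> * M) - arctan (\<rho> * N))"
      using arctan_scaled_has_integral[OF \<rho> that(2)] by (rule integral_unique)
    finally show ?thesis .
  qed
  have tail: "norm (integral {0..M} f - integral {0..N} f) \<le> B / \<rho> * (pi / 2 - arctan (\<rho> * N))"
    if "0 \<le> N" "N \<le> M" for N M
  proof -
    have "B / \<rho> * (arctan (\<rho> * M) - arctan (\<rho> * N)) \<le> B / \<rho> * (pi / 2 - arctan (\<rho> * N))"
      using B \<rho> arctan_ubound[of "\<rho> * M"] by (intro mult_left_mono) auto
    then show ?thesis using diff[OF that] by linarith
  qed
  have tail_lim: "((\<lambda>N. B / \<rho> * (pi / 2 - arctan (\<rho> * N))) \<longlongrightarrow> 0) at_top"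
    using \<rho> by (rule arctan_tail_tendsto_0)
  have "Cauchy (\<lambda>n. integral {0..real n} f)"
  proof (rule metric_CauchyI)
    fix e :: real assume "0 < e"
    then have "\<forall>\<^sub>F N in at_top. dist (B / \<rho> * (pi / 2 - arctan (\<rho> * N))) 0 < e/2"
      using tendstoD[OF tail_lim, of "e/2"] by simp
    then obtain N where N: "\<And>M. M \<ge> N \<Longrightarrow> \<bar>B / \<rho> * (pi / 2 - arctan (\<rho> * M))\<bar> < e/2"
      by (auto simp: eventually_at_top_linorder)
    obtain k :: nat where k: "real k \<ge> N" using real_arch_simple by blast
    have *: "dist (integral {0..real m} f) (integral {0..real k} f) < e / 2" if "k \<le> m" for m
      using order.strict_trans1[OF order_trans[OF tail[of "real k" "real m"] abs_ge_self] N[OF k]] that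
      by (simp add: dist_norm)
    show "\<exists>M. \<forall>m\<ge>M. \<forall>n\<ge>M. dist (integral {0..real m} f) (integral {0..real n} f) < e"
      using * dist_triangle_half_l by blast
  qed
  then obtain I where I: "(\<lambda>n. integral {0..real n} f) \<longlonglongrightarrow> I"
    using Cauchy_convergent convergent_def by blast
  have near: "norm (integral {0..N} f - I) \<le> B / \<rho> * (pi / 2 - arctan (\<rho> * N))" if "0 \<le> N" for N
  proof (rule tendsto_upperbound)
    show "(\<lambda>n. norm (integral {0..N} f - integral {0..real n} f)) \<longlonglongrightarrow> norm (integral {0..N} f - I)"
      by (intro tendsto_intros I)
    obtain k :: nat where k: "real k \<ge> N" using real_arch_simple by blast
    then have "real n \<ge> N" if "n \<ge> k" for n
      using that by (meson of_nat_mono order_trans)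
    then show "\<forall>\<^sub>F n in sequentially. norm (integral {0..N} f - integral {0..real n} f)
        \<le> B / \<rho> * (pi / 2 - arctan (\<rho> * N))"
      unfolding eventually_sequentially
      by (intro exI[of _ k] allI impI) (subst norm_minus_commute, rule tail, use that in auto)
  qed simp
  have "((\<lambda>N. integral {0..N} f - I) \<longlongrightarrow> 0) at_top"
  proof (rule Lim_null_comparison)
    show "\<forall>\<^sub>F N in at_top. norm (integral {0..N} f - I) \<le> B / \<rho> * (pi / 2 - arctan (\<rho> * N))"
      by (rule eventually_mono[OF eventually_ge_at_top[of 0] near])
    show "((\<lambda>N. B / \<rho> * (pi / 2 - arctan (\<rho> * N))) \<longlongrightarrow> 0) at_top" by (rule tail_lim)
  qed
  then have lim: "((\<lambda>N. integral {0..N} f) \<longlongrightarrow> I) at_top"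
    by (simp add: LIM_zero_iff)
  have hI: "(f has_integral I) {0..}"
    using int lim by (rule has_integral_atLeast_0)
  then have I_eq: "integral {0..} f = I" by (rule integral_unique)
  then show "(f has_integral integral {0..} f) {0..}" using hI by simp
  show "((\<lambda>N. integral {0..N} f) \<longlongrightarrow> integral {0..} f) at_top"
    using lim I_eq by simp
  show near': "norm (integral {0..N} f - integral {0..} f) \<le> B / \<rho> * (pi / 2 - arctan (\<rho> * N))"
    if "0 \<le> N" for N
    using near[OF that] I_eq by simp
  show "norm (integral {0..} f) \<le> B * pi / (2 * \<rho>)"
    using near'[of 0] by (simp add: norm_minus_commute field_simps)
qed

lemma integral_norm_bound_const:
  fixes f :: "real \<Rightarrow> 'b::banach"
  assumes "f integrable_on {a..b}" "a \<le> b" "\<And>x. x \<in> {a..b} \<Longrightarrow> norm (f x) \<le> B"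
  shows "norm (integral {a..b} f) \<le> B * (b - a)"
  using integral_norm_bound_integral[OF assms(1) integrable_const_ivl assms(3)] assms(2)
  by (simp add: mult.commute)

text \<open>On [0,N] x [0,c] the integrand is continuous and the order may be exchanged. The tail
  bound does not depend on u, so the inner integrals converge uniformly in u as N grows; this yields
  both the continuity of the limit kernel and the limit of the exchanged integrals.\<close>

lemma improper_integral_swap:
  fixes k :: "real \<Rightarrow> real \<Rightarrow> complex" and F :: "real \<Rightarrow> 'a::complex_banach"
  assumes \<rho>: "0 < \<rho>" and c: "0 \<le> c"
    and k: "continuous_on ({0..} \<times> {0..c}) (\<lambda>(\<xi>, u). k \<xi> u)"
    and le: "\<And>\<xi> u. 0 \<le> \<xi> \<Longrightarrow> u \<in> {0..c} \<Longrightarrow> cmod (k \<xi> u) \<le> B / (1 + (\<rho> * \<xi>)\<^sup>2)"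
    and F: "continuous_on {0..c} F"
  shows "continuous_on {0..c} (\<lambda>u. integral {0..} (\<lambda>\<xi>. k \<xi> u))"
    and "((\<lambda>\<xi>. integral {0..c} (\<lambda>u. k \<xi> u *\<^sub>C F u)) has_integral
          integral {0..c} (\<lambda>u. integral {0..} (\<lambda>\<xi>. k \<xi> u) *\<^sub>C F u)) {0..}"
proof -
  define L where "L u = integral {0..} (\<lambda>\<xi>. k \<xi> u)" for u
  define L' where "L' N u = integral {0..N} (\<lambda>\<xi>. k \<xi> u)" for N u
  have kint: "(\<lambda>\<xi>. k \<xi> u) integrable_on {0..N}" if "u \<in> {0..c}" for u N
    using that by (intro integrable_continuous_real continuous_on_compose2[OF k, of _ "\<lambda>\<xi>. (\<xi>, u)", simplified])
      (auto intro!: continuous_intros)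
  have near: "cmod (L' N u - L u) \<le> B / \<rho> * (pi / 2 - arctan (\<rho> * N))"
    if "0 \<le> N" "u \<in> {0..c}" for N u
    unfolding L_def L'_def using \<rho> kint le that by (intro improper_integral_dominated(2)) auto
  have swapped: "continuous_on ({0..c} \<times> {0..N}) (\<lambda>(u, \<xi>). k \<xi> u)" for N
    unfolding case_prod_unfold
    by (rule continuous_on_compose2[OF k, of _ prod.swap, simplified case_prod_unfold, simplified])
      (auto intro!: continuous_intros simp: prod.swap_def)
  have L'_cont: "continuous_on {0..c} (L' N)" for N
    unfolding L'_def using integral_continuous_on_param[OF swapped[of N, folded box_real(2)]] by simp
  have tail_lim: "((\<lambda>N. B / \<rho> * (pi / 2 - arctan (\<rho> * N))) \<longlongrightarrow> 0) at_top"
    using \<rho> by (rule arctan_tail_tendsto_0)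
  have small: "\<forall>\<^sub>F N in at_top. 0 \<le> N \<and> B / \<rho> * (pi / 2 - arctan (\<rho> * N)) < e" if "0 < e" for e
    using order_tendstoD(2)[OF tail_lim, of e] that
    by (intro eventually_conj eventually_ge_at_top) auto
  have "uniform_limit {0..c} L' L at_top"
    unfolding uniform_limit_iff
  proof (intro allI impI)
    fix e :: real assume "0 < e"
    from small[OF this] show "\<forall>\<^sub>F N in at_top. \<forall>u\<in>{0..c}. dist (L' N u) (L u) < e"
      by eventually_elim (use near in \<open>fastforce simp: dist_norm\<close>)
  qed
  then have L_cont: "continuous_on {0..c} L"
    using L'_cont by (intro uniform_limit_theorem[where f=L' and F=at_top]) auto
  then show "continuous_on {0..c} (\<lambda>u. integral {0..} (\<lambda>\<xi>. k \<xi> u))"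
    unfolding L_def .
  have "compact (F ` {0..c})" using F by (intro compact_continuous_image) auto
  then obtain M where M: "\<And>u. u \<in> {0..c} \<Longrightarrow> norm (F u) \<le> M" "0 < M"
    using compact_imp_bounded[THEN bounded_normE] by (metis bounded_pos compact_imp_bounded imageI)
  have kF: "continuous_on ({0..} \<times> {0..c}) (\<lambda>(\<xi>, u). k \<xi> u *\<^sub>C F u)"
    using k unfolding case_prod_unfold
    by (intro continuous_intros continuous_on_compose2[OF F]) auto
  have sw: "integral {0..N} (\<lambda>\<xi>. integral {0..c} (\<lambda>u. k \<xi> u *\<^sub>C F u)) =
      integral {0..c} (\<lambda>u. L' N u *\<^sub>C F u)" for N
  proof -
    have "continuous_on (cbox (0,0) (N,c)) (\<lambda>(\<xi>, u). k \<xi> u *\<^sub>C F u)"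
      by (rule continuous_on_subset[OF kF]) (auto simp: cbox_Pair_eq)
    from integral_swap_continuous[OF this]
    have "integral {0..N} (\<lambda>\<xi>. integral {0..c} (\<lambda>u. k \<xi> u *\<^sub>C F u)) =
      integral {0..c} (\<lambda>u. integral {0..N} (\<lambda>\<xi>. k \<xi> u *\<^sub>C F u))" by simp
    also have "\<dots> = integral {0..c} (\<lambda>u. L' N u *\<^sub>C F u)"
    proof (rule integral_cong)
      fix u assume "u \<in> {0..c}"
      from integral_linear[OF kint[OF this, of N] scaleC.bounded_linear_left[of "F u"]]
      show "integral {0..N} (\<lambda>\<xi>. k \<xi> u *\<^sub>C F u) = L' N u *\<^sub>C F u"
        by (simp add: o_def L'_def)
    qed
    finally show ?thesis .
  qed
  have diff: "norm (integral {0..c} (\<lambda>u. L' N u *\<^sub>C F u) - integral {0..c} (\<lambda>u. L u *\<^sub>C F u))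
      \<le> B / \<rho> * (pi / 2 - arctan (\<rho> * N)) * M * (c - 0)" if "0 \<le> N" for N
  proof -
    have "integral {0..c} (\<lambda>u. L' N u *\<^sub>C F u) - integral {0..c} (\<lambda>u. L u *\<^sub>C F u)
        = integral {0..c} (\<lambda>u. (L' N u - L u) *\<^sub>C F u)"
      unfolding scaleC.diff_left
      by (intro integral_diff[symmetric] integrable_continuous_real continuous_intros L'_cont L_cont F)
    also have "norm \<dots> \<le> B / \<rho> * (pi / 2 - arctan (\<rho> * N)) * M * (c - 0)"
    proof (rule integral_norm_bound_const[OF _ c])
      show "(\<lambda>u. (L' N u - L u) *\<^sub>C F u) integrable_on {0..c}"
        by (intro integrable_continuous_real continuous_intros L'_cont L_cont F)
      show "norm ((L' N u - L u) *\<^sub>C F u) \<le> B / \<rho> * (pi / 2 - arctan (\<rho> * N)) * M"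
        if "u \<in> {0..c}" for u
        unfolding norm_scaleC using near[OF \<open>0 \<le> N\<close> that] M(1)[OF that] M(2)
        by (intro mult_mono order_trans[OF norm_ge_zero near[OF \<open>0 \<le> N\<close> that]]) auto
    qed
    finally show ?thesis .
  qed
  have "((\<lambda>\<xi>. integral {0..c} (\<lambda>u. k \<xi> u *\<^sub>C F u)) has_integral
      integral {0..c} (\<lambda>u. L u *\<^sub>C F u)) {0..}"
  proof (rule has_integral_atLeast_0)
    fix N :: real
    show "(\<lambda>\<xi>. integral {0..c} (\<lambda>u. k \<xi> u *\<^sub>C F u)) integrable_on {0..N}"
      using integral_continuous_on_param[of "{0..N}" 0 c "\<lambda>\<xi> u. k \<xi> u *\<^sub>C F u"]
        continuous_on_subset[OF kF Sigma_mono[of "{0..N}" "{0..}" "\<lambda>_. {0..c}" "\<lambda>_. {0..c}"]]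
      by (intro integrable_continuous_real) auto
  next
    have "((\<lambda>N. integral {0..N} (\<lambda>\<xi>. integral {0..c} (\<lambda>u. k \<xi> u *\<^sub>C F u))
        - integral {0..c} (\<lambda>u. L u *\<^sub>C F u)) \<longlongrightarrow> 0) at_top"
    proof (rule Lim_null_comparison)
      show "\<forall>\<^sub>F N in at_top. norm (integral {0..N} (\<lambda>\<xi>. integral {0..c} (\<lambda>u. k \<xi> u *\<^sub>C F u))
        - integral {0..c} (\<lambda>u. L u *\<^sub>C F u)) \<le> B / \<rho> * (pi / 2 - arctan (\<rho> * N)) * M * (c - 0)"
        using eventually_ge_at_top[of 0] by eventually_elim (use sw diff in auto)
      show "((\<lambda>N. B / \<rho> * (pi / 2 - arctan (\<rho> * N)) * M * (c - 0)) \<longlongrightarrow> 0) at_top"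
        by (rule tendsto_eq_intros tail_lim refl)+ simp
    qed
    then show "((\<lambda>N. integral {0..N} (\<lambda>\<xi>. integral {0..c} (\<lambda>u. k \<xi> u *\<^sub>C F u))) \<longlongrightarrow>
        integral {0..c} (\<lambda>u. L u *\<^sub>C F u)) at_top"
      by (simp add: LIM_zero_iff)
  qed
  then show "((\<lambda>\<xi>. integral {0..c} (\<lambda>u. k \<xi> u *\<^sub>C F u)) has_integral
      integral {0..c} (\<lambda>u. integral {0..} (\<lambda>\<xi>. k \<xi> u) *\<^sub>C F u)) {0..}"
    unfolding L_def .
qed

section \<open>From half-lines to the whole line\<close>

lemma has_integral_reflect_atLeast_0:
  fixes f :: "real \<Rightarrow> 'b::banach"
  assumes "(f has_integral I) {0..}"
  shows "((\<lambda>x. f (- x)) has_integral I) {..0}"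
proof -
  define g where "g x = (if x \<in> {0..} then f x else 0)" for x
  have g: "(\<lambda>x. if x \<in> {..0} then f (- x) else 0) = (\<lambda>x. g (- x))"
    by (auto simp: g_def)
  from assms have *: "g integrable_on cbox a b" for a b
    by (simp add: has_integral_alt' g_def[abs_def])
  have **: "\<exists>B>0. \<forall>a b. ball 0 B \<subseteq> cbox a b \<longrightarrow> norm (integral (cbox a b) g - I) < e" if "0 < e" for e
    using assms that by (simp add: has_integral_alt' g_def[abs_def])
  show ?thesis
    unfolding has_integral_alt' g
  proof (intro conjI allI impI)
    show "(\<lambda>x. g (- x)) integrable_on cbox a b" for a b
      using *[of "- b" "- a"] integrable_reflect[of g "- a" "- b"] by simp
    fix e :: real assume "0 < e"
    from **[OF this] obtain B
      where B: "B > 0" "\<And>a b. ball 0 B \<subseteq> cbox a b \<Longrightarrow> norm (integral (cbox a b) g - I) < e"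
      by blast
    show "\<exists>B>0. \<forall>a b. ball 0 B \<subseteq> cbox a b \<longrightarrow> norm (integral (cbox a b) (\<lambda>x. g (- x)) - I) < e"
    proof (intro exI[of _ B] conjI allI impI B(1))
      fix a b :: real assume sub: "ball 0 B \<subseteq> cbox a b"
      have "ball 0 B \<subseteq> cbox (- b) (- a)"
      proof
        fix x :: real assume "x \<in> ball 0 B"
        then have "- x \<in> ball 0 B" by simp
        then have "- x \<in> cbox a b" using sub by blast
        then show "x \<in> cbox (- b) (- a)" by simp
      qed
      from B(2)[OF this] show "norm (integral (cbox a b) (\<lambda>x. g (- x)) - I) < e"
        using integral_reflect[of "- a" "- b" g] by simp
    qed
  qed
qed

text \<open>Agreement is required only away from 0, a negligible point, so that the two halves of a
  function with a jump there, such as sgn, can be replaced by continuous functions \<open>p\<close>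
  and \<open>q\<close>.\<close>

lemma has_integral_two_sided:
  fixes f :: "real \<Rightarrow> 'b::banach"
  assumes p: "(p has_integral P) {0..}" and q: "(q has_integral Q) {0..}"
    and fp: "\<And>x. 0 < x \<Longrightarrow> f x = p x" and fq: "\<And>x. 0 < x \<Longrightarrow> f (- x) = q x"
  shows "(f has_integral P + Q) UNIV"
proof -
  have "(f has_integral P) {0..}"
    by (rule has_integral_spike[OF negligible_sing[of 0] _ p]) (simp add: fp)
  moreover have "(f has_integral Q) {..0}"
    using has_integral_reflect_atLeast_0[OF q]
    by (rule has_integral_spike[OF negligible_sing[of 0], rotated]) (metis DiffE fq atMost_iff
       add.inverse_inverse insertI1 neg_0_less_iff_less order_le_less singletonI)
  moreover have "negligible ({0..} \<inter> {..(0::real)})"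
    by (rule negligible_subset[of "{0}"]) auto
  moreover have "{0..} \<union> {..(0::real)} = UNIV" by auto
  ultimately show ?thesis using has_integral_Un by metis
qed

section \<open>Dawson's function\<close>

text \<open>Equivalent to (1 + y^2)^2 \<le> 8 exp(y^2/2). The quadratic Taylor bound for exp at
  y^2/2 ends in y^4/8, so 8 is the factor that makes the quartic terms match.\<close>

lemma gauss_decay: "exp (- (y\<^sup>2) / 2) * (1 + y\<^sup>2) \<le> 8 / (1 + y\<^sup>2)" for y :: real
proof -
  have "(1 + y\<^sup>2) * (1 + y\<^sup>2) \<le> 8 * (1 + y\<^sup>2 / 2 + (y\<^sup>2 / 2)\<^sup>2 / 2)"
    by (simp add: field_simps power2_eq_square)
  also have "\<dots> \<le> 8 * exp (y\<^sup>2 / 2)"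
    using exp_lower_Taylor_quadratic[of "y\<^sup>2 / 2"] by (intro mult_left_mono) auto
  finally have "(1 + y\<^sup>2) * (1 + y\<^sup>2) * exp (- (y\<^sup>2 / 2)) \<le> 8 * exp (y\<^sup>2 / 2) * exp (- (y\<^sup>2 / 2))"
    by (rule mult_right_mono) simp
  then have "(1 + y\<^sup>2) * (1 + y\<^sup>2) * exp (- (y\<^sup>2 / 2)) \<le> 8"
    by (simp add: mult.assoc exp_add[symmetric])
  moreover have "0 < 1 + y\<^sup>2" by (simp add: add_pos_nonneg)
  ultimately show ?thesis by (simp add: pos_le_divide_eq mult_ac)
qed

lemma gauss_le: "exp (- (y\<^sup>2) / 2) \<le> 8 / (1 + y\<^sup>2)" for y :: real
  using order_trans[OF _ gauss_decay[of y]] by simp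

text \<open>With Dawson's integral D(x) = exp(-x^2) times the integral of exp(t^2) over [0,x], this
  is (sqrt 2 / rho) D(sigma / (sqrt 2 rho)). It is a Gaussian regularisation of the divergent
  integral of sin(sigma xi) over the half-line, whose formal value is 1/sigma.\<close>

definition dawson :: "real \<Rightarrow> real \<Rightarrow> real" where
  "dawson \<rho> \<sigma> = integral {0..} (\<lambda>\<xi>. exp (- ((\<rho> * \<xi>)\<^sup>2) / 2) * sin (\<sigma> * \<xi>))"

lemma dawson_integrand_le:
  fixes \<rho> \<sigma> \<xi> :: real
  shows "\<bar>exp (- ((\<rho> * \<xi>)\<^sup>2) / 2) * sin (\<sigma> * \<xi>)\<bar> \<le> 8 / (1 + (\<rho> * \<xi>)\<^sup>2)"
  using mult_mono[OF gauss_le[of "\<rho> * \<xi>"] abs_sin_le_one[of "\<sigma> * \<xi>"]]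
  by (simp add: abs_mult)

lemma dawson_has_integral:
  assumes "0 < \<rho>"
  shows "((\<lambda>\<xi>. exp (- ((\<rho> * \<xi>)\<^sup>2) / 2) * sin (\<sigma> * \<xi>)) has_integral dawson \<rho> \<sigma>) {0..}"
  unfolding dawson_def using assms dawson_integrand_le
  by (intro improper_integral_dominated(1)[OF assms, where B = 8] integrable_continuous_real
      continuous_intros) auto

lemma abs_dawson_le:
  assumes "0 < \<rho>"
  shows "\<bar>dawson \<rho> \<sigma>\<bar> \<le> 4 * pi / \<rho>"
proof -
  have "norm (dawson \<rho> \<sigma>) \<le> 8 * pi / (2 * \<rho>)"
    unfolding dawson_def using dawson_integrand_le
    by (intro improper_integral_dominated(3)[OF assms, where B = 8] integrable_continuous_real
        continuous_intros) auto
  then show ?thesis by simp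
qed

text \<open>Integrating by parts twice.\<close>
lemma dawson_asymptotics:
  assumes \<rho>: "0 < \<rho>" and \<sigma>: "\<sigma> \<noteq> 0"
  shows "\<bar>dawson \<rho> \<sigma> - 1 / \<sigma>\<bar> \<le> 4 * pi * \<rho> / \<sigma>\<^sup>2"
proof -
  define E where "E \<xi> = exp (- ((\<rho> * \<xi>)\<^sup>2) / 2)" for \<xi>
  \<comment> \<open>\<open>A\<close> collects the boundary terms of the two integrations by parts
    and \<open>q\<close> the integrand left over: the derivative of \<open>A\<close> is E sin(sigma
    xi) - q. Since \<open>A\<close> vanishes at infinity, the main term is - A 0 = 1/sigma and the
    error is the integral of \<open>q\<close>.\<close>
  define A where "A \<xi> = - E \<xi> * cos (\<sigma> * \<xi>) / \<sigma> - \<rho>\<^sup>2 * \<xi> * E \<xi> * sin (\<sigma> * \<xi>) / \<sigma>\<^sup>2" for \<xi>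
  define q where "q \<xi> = (\<rho>\<^sup>2 - \<rho>^4 * \<xi>\<^sup>2) * E \<xi> * sin (\<sigma> * \<xi>) / \<sigma>\<^sup>2" for \<xi>
  have q_le: "\<bar>q \<xi>\<bar> \<le> (8 * \<rho>\<^sup>2 / \<sigma>\<^sup>2) / (1 + (\<rho> * \<xi>)\<^sup>2)" for \<xi>
  proof -
    have "q \<xi> = \<rho>\<^sup>2 / \<sigma>\<^sup>2 * ((1 - (\<rho> * \<xi>)\<^sup>2) * E \<xi> * sin (\<sigma> * \<xi>))"
      by (simp add: q_def field_simps power2_eq_square power4_eq_xxxx)
    then have "\<bar>q \<xi>\<bar> = \<rho>\<^sup>2 / \<sigma>\<^sup>2 * (\<bar>1 - (\<rho> * \<xi>)\<^sup>2\<bar> * E \<xi> * \<bar>sin (\<sigma> * \<xi>)\<bar>)"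
      by (simp add: abs_mult E_def)
    also have "\<dots> \<le> \<rho>\<^sup>2 / \<sigma>\<^sup>2 * ((1 + (\<rho> * \<xi>)\<^sup>2) * E \<xi> * 1)"
      by (intro mult_left_mono mult_mono) (auto simp: E_def abs_le_iff intro: order_trans)
    also have "\<dots> \<le> \<rho>\<^sup>2 / \<sigma>\<^sup>2 * (8 / (1 + (\<rho> * \<xi>)\<^sup>2))"
      using gauss_decay[of "\<rho> * \<xi>"] by (intro mult_left_mono) (auto simp: E_def mult.commute)
    finally show ?thesis by (simp add: mult.commute)
  qed
  have q_int: "q integrable_on {0..N}" for N
    unfolding q_def E_def using \<sigma> by (intro integrable_continuous_real continuous_intros) auto
  have E_int: "(\<lambda>\<xi>. E \<xi> * sin (\<sigma> * \<xi>)) integrable_on {0..N}" for N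
    unfolding E_def by (intro integrable_continuous_real continuous_intros) auto
  have lim1: "((\<lambda>N. integral {0..N} (\<lambda>\<xi>. E \<xi> * sin (\<sigma> * \<xi>))) \<longlongrightarrow> dawson \<rho> \<sigma>) at_top"
    unfolding dawson_def E_def
    using dawson_integrand_le E_int[unfolded E_def] by (intro improper_integral_dominated(4)[OF \<rho>, where B = 8]) auto
  have lim2: "((\<lambda>N. integral {0..N} q) \<longlongrightarrow> integral {0..} q) at_top"
    using q_le q_int by (intro improper_integral_dominated(4)[OF \<rho>, where B = "8 * \<rho>\<^sup>2 / \<sigma>\<^sup>2"]) auto
  have parts: "integral {0..N} (\<lambda>\<xi>. E \<xi> * sin (\<sigma> * \<xi>)) - integral {0..N} q = A N + 1 / \<sigma>"
    if "0 \<le> N" for N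
  proof -
    have "((\<lambda>\<xi>. E \<xi> * sin (\<sigma> * \<xi>) - q \<xi>) has_integral A N - A 0) {0..N}"
    proof (rule fundamental_theorem_of_calculus[OF that])
      fix \<xi>
      have dE: "(E has_real_derivative - \<rho>\<^sup>2 * \<xi> * E \<xi>) (at \<xi> within {0..N})"
        unfolding E_def[abs_def]
        by (auto intro!: derivative_eq_intros simp: power2_eq_square)
      have "(A has_real_derivative E \<xi> * sin (\<sigma> * \<xi>) - q \<xi>) (at \<xi> within {0..N})"
        unfolding A_def[abs_def] q_def using \<sigma>
        by (auto intro!: derivative_eq_intros dE
            simp: field_simps power2_eq_square power4_eq_xxxx)
      then show "(A has_vector_derivative E \<xi> * sin (\<sigma> * \<xi>) - q \<xi>) (at \<xi> within {0..N})"
        by (simp add: has_real_derivative_iff_has_vector_derivative)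
    qed
    then have "integral {0..N} (\<lambda>\<xi>. E \<xi> * sin (\<sigma> * \<xi>) - q \<xi>) = A N - A 0"
      by (rule integral_unique)
    then show ?thesis
      using integral_diff[OF E_int q_int] by (simp add: A_def E_def)
  qed
  have A_le: "\<bar>A N\<bar> \<le> (1 / \<bar>\<sigma>\<bar> + \<rho> / \<sigma>\<^sup>2) * (8 / (1 + (\<rho> * N)\<^sup>2))" for N
  proof -
    have E0: "0 \<le> E N" by (simp add: E_def)
    have "\<bar>A N\<bar> \<le> E N * \<bar>cos (\<sigma> * N)\<bar> / \<bar>\<sigma>\<bar> + \<rho> * (\<bar>\<rho> * N\<bar> * E N) * \<bar>sin (\<sigma> * N)\<bar> / \<sigma>\<^sup>2"
      unfolding A_def using \<rho> E0
      by (intro order_trans[OF abs_triangle_ineq4] add_mono)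
        (auto simp: abs_mult power2_eq_square mult_ac)
    also have "\<dots> \<le> E N * 1 / \<bar>\<sigma>\<bar> + \<rho> * ((1 + (\<rho> * N)\<^sup>2) * E N) * 1 / \<sigma>\<^sup>2"
    proof -
      have "\<bar>\<rho> * N\<bar> \<le> 1 + (\<rho> * N)\<^sup>2"
        using zero_le_power2[of "\<bar>\<rho> * N\<bar> - 1"] by (simp add: power2_eq_square algebra_simps) 
      then show ?thesis using \<rho> E0
        by (intro add_mono divide_right_mono mult_mono) auto
    qed
    also have "\<dots> \<le> 8 / (1 + (\<rho> * N)\<^sup>2) / \<bar>\<sigma>\<bar> + \<rho> * (8 / (1 + (\<rho> * N)\<^sup>2)) / \<sigma>\<^sup>2"
      using gauss_decay[of "\<rho> * N"] gauss_le[of "\<rho> * N"] \<rho>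
      unfolding mult_1_right mult.commute[of _ "E N"]
      by (intro add_mono divide_right_mono mult_left_mono) (auto simp: E_def)
    finally show ?thesis by (simp add: add_divide_distrib mult_ac)
  qed
  have "(A \<longlongrightarrow> 0) at_top"
  proof (rule Lim_null_comparison)
    show "\<forall>\<^sub>F N in at_top. norm (A N) \<le> (1 / \<bar>\<sigma>\<bar> + \<rho> / \<sigma>\<^sup>2) * (8 / (1 + (\<rho> * N)\<^sup>2))"
      using A_le by simp
    have "filterlim (\<lambda>N. 1 + (\<rho> * N)\<^sup>2) at_top at_top"
      using \<rho> by (intro filterlim_tendsto_add_at_top[OF tendsto_const] filterlim_pow_at_top
          filterlim_tendsto_pos_mult_at_top[OF tendsto_const _ filterlim_ident]) auto
    then have "((\<lambda>N. 8 / (1 + (\<rho> * N)\<^sup>2)) \<longlongrightarrow> 0) at_top"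
      by (intro tendsto_divide_0[OF tendsto_const] filterlim_at_top_imp_at_infinity)
    then show "((\<lambda>N. (1 / \<bar>\<sigma>\<bar> + \<rho> / \<sigma>\<^sup>2) * (8 / (1 + (\<rho> * N)\<^sup>2))) \<longlongrightarrow> 0) at_top"
      by (rule tendsto_mult_right_zero)
  qed
  then have "((\<lambda>N. A N + 1 / \<sigma>) \<longlongrightarrow> 0 + 1 / \<sigma>) at_top" by (intro tendsto_intros)
  moreover have "((\<lambda>N. A N + 1 / \<sigma>) \<longlongrightarrow> dawson \<rho> \<sigma> - integral {0..} q) at_top"
    using tendsto_diff[OF lim1 lim2]
    by (rule Lim_transform_eventually) (rule eventually_mono[OF eventually_ge_at_top[of 0] parts])
  ultimately have "1 / \<sigma> = dawson \<rho> \<sigma> - integral {0..} q"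
    using tendsto_unique[OF trivial_limit_at_top_linorder] by fastforce
  moreover have "norm (integral {0..} q) \<le> 8 * \<rho>\<^sup>2 / \<sigma>\<^sup>2 * pi / (2 * \<rho>)"
    using q_le q_int by (intro improper_integral_dominated(3)[OF \<rho>]) auto
  moreover have "8 * \<rho>\<^sup>2 / \<sigma>\<^sup>2 * pi / (2 * \<rho>) = 4 * pi * \<rho> / \<sigma>\<^sup>2"
    using \<rho> by (simp add: field_simps power2_eq_square)
  ultimately show ?thesis by (simp add: algebra_simps)
qed

text \<open>For |s| \<ge> r the asymptotic expansion gives the error 4 pi r / s^2, for |s| < r the
  uniform bound gives 4 pi / r. In each case the larger of r^2 and s^2 is at least half of their
  sum, which turns both into the same integrable majorant.\<close>

lemma dawson_minus_truncated_le:
  assumes r: "0 < r"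
  shows "\<bar>2 * pi * dawson (2 * pi * r) (2 * pi * s) - (if r \<le> \<bar>s\<bar> then 1 / s else 0)\<bar>
    \<le> 8 * pi * r / (r\<^sup>2 + s\<^sup>2)"
proof (cases "r \<le> \<bar>s\<bar>")
  case True
  then have s: "s \<noteq> 0" and sq: "r\<^sup>2 \<le> s\<^sup>2" using r abs_le_square_iff[of r s] by auto
  have "2 * pi * d - 1 / s = 2 * pi * (d - 1 / (2 * pi * s))" for d
    using s by (simp add: field_simps)
  then have "\<bar>2 * pi * dawson (2 * pi * r) (2 * pi * s) - 1 / s\<bar>
      = 2 * pi * \<bar>dawson (2 * pi * r) (2 * pi * s) - 1 / (2 * pi * s)\<bar>"
    by (simp add: abs_mult)
  also have "\<dots> \<le> 2 * pi * (4 * pi * (2 * pi * r) / (2 * pi * s)\<^sup>2)"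
    using r s by (intro mult_left_mono dawson_asymptotics) auto
  also have "\<dots> = 8 * pi * r / (s\<^sup>2 + s\<^sup>2)"
    using s by (simp add: field_simps power2_eq_square)
  also have "\<dots> \<le> 8 * pi * r / (r\<^sup>2 + s\<^sup>2)"
    using r s sq by (intro divide_left_mono) (auto intro!: mult_pos_pos add_pos_pos)
  finally show ?thesis using True by simp
next
  case False
  then have sq: "s\<^sup>2 \<le> r\<^sup>2" using r abs_le_square_iff[of s r] by auto
  have "\<bar>2 * pi * dawson (2 * pi * r) (2 * pi * s)\<bar> \<le> 2 * pi * (4 * pi / (2 * pi * r))"
    unfolding abs_mult using r by (intro mult_mono abs_dawson_le) auto
  also have "\<dots> = 8 * pi * r / (r\<^sup>2 + r\<^sup>2)"
    using r by (simp add: field_simps power2_eq_square)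
  also have "\<dots> \<le> 8 * pi * r / (r\<^sup>2 + s\<^sup>2)"
    using r sq by (intro divide_left_mono) (auto intro!: mult_pos_pos add_pos_nonneg)
  finally show ?thesis using False by simp
qed

text \<open>The line is split at 0, where \<open>k\<close> may jump; \<open>p\<close> and
  \<open>q\<close> are its continuous versions on the two sides, the left one reflected. The total
  kernel \<open>K\<close> is prescribed, so that a closed form found elsewhere can be
  inserted.\<close>

lemma improper_integral_swap_UNIV:
  fixes k p q :: "real \<Rightarrow> real \<Rightarrow> complex" and F :: "real \<Rightarrow> 'a::complex_banach"
  assumes \<rho>: "0 < \<rho>" and c: "0 \<le> c"
    and p: "continuous_on ({0..} \<times> {0..c}) (\<lambda>(\<xi>, u). p \<xi> u)"
    and q: "continuous_on ({0..} \<times> {0..c}) (\<lambda>(\<xi>, u). q \<xi> u)"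
    and p_le: "\<And>\<xi> u. 0 \<le> \<xi> \<Longrightarrow> u \<in> {0..c} \<Longrightarrow> cmod (p \<xi> u) \<le> B / (1 + (\<rho> * \<xi>)\<^sup>2)"
    and q_le: "\<And>\<xi> u. 0 \<le> \<xi> \<Longrightarrow> u \<in> {0..c} \<Longrightarrow> cmod (q \<xi> u) \<le> B / (1 + (\<rho> * \<xi>)\<^sup>2)"
    and F: "continuous_on {0..c} F"
    and kp: "\<And>\<xi> u. 0 < \<xi> \<Longrightarrow> k \<xi> u = p \<xi> u"
    and kq: "\<And>\<xi> u. 0 < \<xi> \<Longrightarrow> k (- \<xi>) u = q \<xi> u"
    and K: "\<And>u. u \<in> {0..c} \<Longrightarrow> ((\<lambda>\<xi>. k \<xi> u) has_integral K u) UNIV"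
  shows "continuous_on {0..c} K"
    and "((\<lambda>\<xi>. integral {0..c} (\<lambda>u. k \<xi> u *\<^sub>C F u)) has_integral
          integral {0..c} (\<lambda>u. K u *\<^sub>C F u)) UNIV"
proof -
  note P = improper_integral_swap[OF \<rho> c p p_le F]
  note Q = improper_integral_swap[OF \<rho> c q q_le F]
  have int: "(\<lambda>\<xi>. h \<xi> u) integrable_on {0..N}"
    if h: "continuous_on ({0..} \<times> {0..c}) (\<lambda>(\<xi>, u). h \<xi> u)" and "u \<in> {0..c}"
    for h :: "real \<Rightarrow> real \<Rightarrow> complex" and u N
    using that(2) by (intro integrable_continuous_real continuous_on_compose2[OF h, of _ "\<lambda>\<xi>. (\<xi>, u)", simplified])
      (auto intro!: continuous_intros)
  have K_eq: "integral {0..} (\<lambda>\<xi>. p \<xi> u) + integral {0..} (\<lambda>\<xi>. q \<xi> u) = K u" if u: "u \<in> {0..c}" for u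
  proof -
    have "((\<lambda>\<xi>. k \<xi> u) has_integral integral {0..} (\<lambda>\<xi>. p \<xi> u) + integral {0..} (\<lambda>\<xi>. q \<xi> u)) UNIV"
      using \<rho> p_le q_le u int[OF p u] int[OF q u]
      by (intro has_integral_two_sided[OF improper_integral_dominated(1)[where B = B and \<rho> = \<rho>]
            improper_integral_dominated(1)[where B = B and \<rho> = \<rho>]] kp kq) auto
    then show ?thesis using K[OF u] has_integral_unique by blast
  qed
  show "continuous_on {0..c} K"
    using continuous_on_add[OF P(1) Q(1)] K_eq by (subst continuous_on_cong[OF refl K_eq[symmetric]]) auto
  have "((\<lambda>\<xi>. integral {0..c} (\<lambda>u. k \<xi> u *\<^sub>C F u)) has_integral
        integral {0..c} (\<lambda>u. integral {0..} (\<lambda>\<xi>. p \<xi> u) *\<^sub>C F u) +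
        integral {0..c} (\<lambda>u. integral {0..} (\<lambda>\<xi>. q \<xi> u) *\<^sub>C F u)) UNIV"
    by (rule has_integral_two_sided[OF P(2) Q(2)]) (auto simp: kp kq)
  also have "integral {0..c} (\<lambda>u. integral {0..} (\<lambda>\<xi>. p \<xi> u) *\<^sub>C F u) +
        integral {0..c} (\<lambda>u. integral {0..} (\<lambda>\<xi>. q \<xi> u) *\<^sub>C F u)
      = integral {0..c} (\<lambda>u. integral {0..} (\<lambda>\<xi>. p \<xi> u) *\<^sub>C F u + integral {0..} (\<lambda>\<xi>. q \<xi> u) *\<^sub>C F u)"
    by (intro integral_add[symmetric] integrable_continuous_real continuous_intros P(1) Q(1) F)
  also have "\<dots> = integral {0..c} (\<lambda>u. K u *\<^sub>C F u)"
    by (intro integral_cong) (simp add: K_eq scaleC.add_left[symmetric])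
  finally show "((\<lambda>\<xi>. integral {0..c} (\<lambda>u. k \<xi> u *\<^sub>C F u)) has_integral
          integral {0..c} (\<lambda>u. K u *\<^sub>C F u)) UNIV" .
qed

section \<open>Gaussian smoothing\<close>

text \<open>Each of the i factors |v| is bounded by C exp(y), where y is so small a share of the
  exponent that exp(i y) is still absorbed by the Gaussian.\<close>

lemma power_times_gauss_le:
  fixes v \<kappa> :: real
  assumes \<kappa>: "0 < \<kappa>"
  shows "\<bar>v\<bar> ^ i * exp (- (\<kappa> * v\<^sup>2) / 2) \<le> (1 + 2 * real (Suc i) / \<kappa>) ^ i"
proof -
  define C where "C = 1 + 2 * real (Suc i) / \<kappa>"
  \<comment> \<open>The share is 1/(i+1) rather than 1/i, so that i = 0 causes no division by
    zero.\<close>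
  define y where "y = \<kappa> * v\<^sup>2 / (2 * real (Suc i))"
  have C: "1 \<le> C" using \<kappa> by (simp add: C_def)
  have y: "0 \<le> y" using \<kappa> by (simp add: y_def)
  have "v\<^sup>2 = 2 * real (Suc i) / \<kappa> * y" using \<kappa> by (simp add: y_def del: of_nat_Suc)
  also have "\<dots> \<le> C * y" using y by (intro mult_right_mono) (auto simp: C_def)
  finally have "1 + v\<^sup>2 \<le> C * (1 + y)" using C by (simp add: distrib_left)
  moreover have "\<bar>v\<bar> \<le> 1 + v\<^sup>2"
    using zero_le_power2[of "\<bar>v\<bar> - 1"] by (simp add: power2_eq_square algebra_simps)
  moreover have "C * (1 + y) \<le> C * exp y"
    using C by (intro mult_left_mono) auto
  ultimately have "\<bar>v\<bar> \<le> C * exp y" by linarith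
  then have "\<bar>v\<bar> ^ i \<le> (C * exp y) ^ i" by (rule power_mono) simp
  also have "\<dots> = C ^ i * exp (real i * y)"
    by (simp add: power_mult_distrib exp_of_nat_mult)
  also have "\<dots> \<le> C ^ i * exp (real (Suc i) * y)"
    using C y by (intro mult_left_mono) (auto intro!: mult_right_mono)
  also have "real (Suc i) * y = \<kappa> * v\<^sup>2 / 2" by (simp add: y_def del: of_nat_Suc)
  finally have "\<bar>v\<bar> ^ i * exp (- (\<kappa> * v\<^sup>2 / 2)) \<le> C ^ i * exp (\<kappa> * v\<^sup>2 / 2) * exp (- (\<kappa> * v\<^sup>2 / 2))"
    by (rule mult_right_mono) simp
  then show ?thesis by (simp add: C_def mult.assoc exp_add[symmetric])
qed

lemma poly_times_gauss_bounded:
  fixes \<kappa> :: real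
  assumes \<kappa>: "0 < \<kappa>"
  obtains B where "\<And>v. \<bar>poly p v\<bar> * exp (- (\<kappa> * v\<^sup>2) / 2) \<le> B"
proof
  fix v
  have "\<bar>poly p v\<bar> * exp (- (\<kappa> * v\<^sup>2) / 2) \<le> (\<Sum>i\<le>degree p. \<bar>coeff p i * v ^ i\<bar>) * exp (- (\<kappa> * v\<^sup>2) / 2)"
    unfolding poly_altdef by (intro mult_right_mono sum_abs) simp
  also have "\<dots> = (\<Sum>i\<le>degree p. \<bar>coeff p i\<bar> * (\<bar>v\<bar> ^ i * exp (- (\<kappa> * v\<^sup>2) / 2)))"
    by (simp add: sum_distrib_right abs_mult power_abs mult.assoc)
  also have "\<dots> \<le> (\<Sum>i\<le>degree p. \<bar>coeff p i\<bar> * (1 + 2 * real (Suc i) / \<kappa>) ^ i)"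
    by (intro sum_mono mult_left_mono power_times_gauss_le[OF \<kappa>]) simp
  finally show "\<bar>poly p v\<bar> * exp (- (\<kappa> * v\<^sup>2) / 2)
      \<le> (\<Sum>i\<le>degree p. \<bar>coeff p i\<bar> * (1 + 2 * real (Suc i) / \<kappa>) ^ i)" .
qed

text \<open>The polynomial factor of the n-th derivative of exp(- kappa t^2 / 2): a rescaled Hermite
  polynomial, (- sqrt kappa)^n He_n(sqrt kappa t) for kappa > 0.\<close>

primrec gauss_poly :: "real \<Rightarrow> nat \<Rightarrow> real poly" where
  "gauss_poly \<kappa> 0 = 1"
| "gauss_poly \<kappa> (Suc n) = pderiv (gauss_poly \<kappa> n) - smult \<kappa> (pCons 0 (gauss_poly \<kappa> n))"

lemma gauss_poly_deriv:
  "((\<lambda>t. poly (gauss_poly \<kappa> n) t * exp (- (\<kappa> * t\<^sup>2) / 2)) has_real_derivative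
    poly (gauss_poly \<kappa> (Suc n)) t * exp (- (\<kappa> * t\<^sup>2) / 2)) (at t within S)"
  by (auto intro!: derivative_eq_intros simp: algebra_simps)

text \<open>All derivatives fall on the Gaussian, whatever the regularity of \<open>F\<close>. Since
  u stays in [0,c], a power of t is dominated by a polynomial in t - u, and a polynomial times a
  Gaussian is bounded.\<close>

lemma schwartz_gauss_smoothing:
  fixes F :: "real \<Rightarrow> 'a::complex_banach"
  assumes r: "0 < r" and c: "0 \<le> c" and F: "continuous_on {0..c} F"
  shows "schwartz (\<lambda>t. integral {0..c} (\<lambda>u. normal_density 0 r (t - u) *\<^sub>R F u))"
proof -
  define \<kappa> where "\<kappa> = 1 / r\<^sup>2"
  define A where "A = 1 / sqrt (2 * pi * r\<^sup>2)"
  define G where "G n t = A * (poly (gauss_poly \<kappa> n) t * exp (- (\<kappa> * t\<^sup>2) / 2))" for n t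
  define D where "D n t = integral {0..c} (\<lambda>u. G n (t - u) *\<^sub>R F u)" for n t
  have \<kappa>: "0 < \<kappa>" using r by (simp add: \<kappa>_def)
  have G0: "G 0 = normal_density 0 r"
    using r by (auto simp: G_def normal_density_def A_def \<kappa>_def fun_eq_iff field_simps)
  have dG: "(G n has_real_derivative G (Suc n) t) (at t within S)" for n t S
    unfolding G_def[abs_def] by (intro DERIV_cmult gauss_poly_deriv)
  have G_cont: "continuous_on S (G n)" for S n
    unfolding G_def[abs_def] by (intro continuous_intros) auto
  have GF: "continuous_on (S \<times> {0..c}) (\<lambda>(t, u). G n (t - u) *\<^sub>R F u)" for n S
    unfolding case_prod_unfold
    by (intro continuous_intros continuous_on_compose2[OF G_cont[of UNIV]] continuous_on_compose2[OF F]) auto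
  have GF_int: "(\<lambda>u. G n (t - u) *\<^sub>R F u) integrable_on {0..c}" for n t
    by (intro integrable_continuous_real continuous_intros F continuous_on_compose2[OF G_cont[of UNIV]]) auto
  have deriv: "(D n has_vector_derivative D (Suc n) t) (at t)" for n t
    unfolding D_def[abs_def] cbox_interval[symmetric]
  proof (rule leibniz_rule_vector_derivative[where U = UNIV])
    fix t u
    have "((\<lambda>t. t - u) has_real_derivative 1) (at t)"
      by (auto intro!: derivative_eq_intros)
    from DERIV_chain2[OF dG this]
    have "((\<lambda>t. G n (t - u)) has_vector_derivative G (Suc n) (t - u)) (at t)"
      by (simp add: has_real_derivative_iff_has_vector_derivative)
    from has_vector_derivative_scaleR[OF this[unfolded has_real_derivative_iff_has_vector_derivative[symmetric]]
        has_vector_derivative_const[of "F u"]]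
    show "((\<lambda>t. G n (t - u) *\<^sub>R F u) has_vector_derivative G (Suc n) (t - u) *\<^sub>R F u) (at t)"
      by simp
  qed (use GF GF_int in auto)
  have "compact (F ` {0..c})" using F by (intro compact_continuous_image) auto
  then obtain M where M: "\<And>u. u \<in> {0..c} \<Longrightarrow> norm (F u) \<le> M" "0 < M"
    by (metis bounded_pos compact_imp_bounded imageI)
  have bdd: "bounded (range (\<lambda>t. t ^ k *\<^sub>R D n t))" for n k
  proof -
    \<comment> \<open>The polynomial \<open>[:1 + c, 0, 1:]\<close> is 1 + c + v^2; it dominates |t|
      for t = v + u because |v| \<le> 1 + v^2 and 0 \<le> u \<le> c.\<close>
    obtain B where B: "\<And>v. \<bar>poly ([:1 + c, 0, 1:] ^ k * gauss_poly \<kappa> n) v\<bar> * exp (- (\<kappa> * v\<^sup>2) / 2) \<le> B"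
      using poly_times_gauss_bounded[OF \<kappa>] by blast
    have G_le: "\<bar>t\<bar> ^ k * \<bar>G n (t - u)\<bar> \<le> \<bar>A\<bar> * B" if "u \<in> {0..c}" for t u
    proof -
      define v where "v = t - u"
      have "\<bar>v\<bar> \<le> 1 + v\<^sup>2"
        using zero_le_power2[of "\<bar>v\<bar> - 1"] by (simp add: power2_eq_square algebra_simps)
      then have "\<bar>t\<bar> \<le> 1 + c + v\<^sup>2" using that by (auto simp: v_def)
      then have "\<bar>t\<bar> ^ k \<le> (1 + c + v\<^sup>2) ^ k" by (rule power_mono) simp
      also have "\<dots> = \<bar>poly ([:1 + c, 0, 1:] ^ k) v\<bar>"
        using c by (simp add: poly_power power2_eq_square power_abs add.assoc[symmetric])
      finally have "\<bar>t\<bar> ^ k * \<bar>G n v\<bar> \<le> \<bar>poly ([:1 + c, 0, 1:] ^ k) v\<bar> * \<bar>G n v\<bar>"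
        by (rule mult_right_mono) simp
      also have "\<dots> = \<bar>A\<bar> * (\<bar>poly ([:1 + c, 0, 1:] ^ k * gauss_poly \<kappa> n) v\<bar> * exp (- (\<kappa> * v\<^sup>2) / 2))"
        by (simp add: G_def abs_mult)
      also have "\<dots> \<le> \<bar>A\<bar> * B" by (intro mult_left_mono B) simp
      finally show ?thesis by (simp add: v_def)
    qed
    have "norm (t ^ k *\<^sub>R D n t) \<le> \<bar>A\<bar> * B * M * (c - 0)" for t
    proof -
      have "t ^ k *\<^sub>R D n t = integral {0..c} (\<lambda>u. (t ^ k * G n (t - u)) *\<^sub>R F u)"
        unfolding D_def by (simp flip: integral_cmul)
      also have "norm \<dots> \<le> \<bar>A\<bar> * B * M * (c - 0)"
      proof (rule integral_norm_bound_const[OF _ c])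
        show "(\<lambda>u. (t ^ k * G n (t - u)) *\<^sub>R F u) integrable_on {0..c}"
          using integrable_cmul[OF GF_int, of "t ^ k"] by simp
        fix u assume u: "u \<in> {0..c}"
        show "norm ((t ^ k * G n (t - u)) *\<^sub>R F u) \<le> \<bar>A\<bar> * B * M"
          unfolding norm_scaleR abs_mult power_abs
          by (intro mult_mono G_le[OF u] M(1)[OF u] order_trans[OF _ G_le[OF u, of t]]) auto
      qed
      finally show ?thesis .
    qed
    then show ?thesis by (auto simp: bounded_iff)
  qed
  have "D 0 = (\<lambda>t. integral {0..c} (\<lambda>u. normal_density 0 r (t - u) *\<^sub>R F u))"
    by (simp add: D_def[abs_def] G0)
  then show ?thesis unfolding schwartz_def using deriv bdd by blast
qed

text \<open>The substitution t = u + r x reduces this to the characteristic function of the standard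
  normal law at - 2 pi r xi; the shift by u contributes the phase.\<close>

lemma gauss_fourier_scalar:
  assumes r: "0 < r"
  shows "((\<lambda>t. cis (- (2 * pi * t * \<xi>)) * complex_of_real (normal_density 0 r (t - u))) has_integral
    complex_of_real (exp (- ((2 * pi * r * \<xi>)\<^sup>2) / 2)) * cis (- (2 * pi * u * \<xi>))) UNIV"
proof -
  define f where "f t = cis (- (2 * pi * t * \<xi>)) * complex_of_real (normal_density 0 r (t - u))" for t
  define w where "w = - (2 * pi * r * \<xi>)"
  have cis_meas: "(\<lambda>t. cis (a * t)) \<in> borel_measurable borel" for a
    by (intro borel_measurable_continuous_onI continuous_intros)
  have f_meas: "f \<in> borel_measurable lborel"
    unfolding f_def[abs_def] using cis_meas[of "- (2 * pi * \<xi>)"] by (simp add: mult_ac)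
  have nd: "normal_density 0 r (t - u) = normal_density u r t" for t
    by (simp add: normal_density_def)
  have f_int: "integrable lborel f"
    by (rule Bochner_Integration.integrable_bound[OF integrable_normal_density[OF r, of u] f_meas])
      (simp add: f_def norm_mult nd)
  have "char std_normal_distribution w = complex_of_real (exp (- (w\<^sup>2) / 2))"
    by (simp add: char_std_normal_distribution)
  also have "char std_normal_distribution w =
      (\<integral>x. std_normal_density x *\<^sub>R cis (w * x) \<partial>lborel)"
    unfolding char_def using cis_meas[of w]
    by (subst integral_density) (auto simp: cis_conv_exp)
  finally have std: "(\<integral>x. std_normal_density x *\<^sub>R cis (w * x) \<partial>lborel) = complex_of_real (exp (- (w\<^sup>2) / 2))" .
  have "integral\<^sup>L lborel f = \<bar>r\<bar> *\<^sub>R (\<integral>x. f (u + r * x) \<partial>lborel)"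
    using r by (intro lborel_integral_real_affine) auto
  also have "(\<lambda>x. f (u + r * x)) = (\<lambda>x. cis (- (2 * pi * u * \<xi>)) * ((1 / r) *\<^sub>R (std_normal_density x *\<^sub>R cis (w * x))))"
  proof
    fix x
    have "normal_density 0 r (r * x) = (1 / r) * std_normal_density x"
      using r by (simp add: normal_density_def power_mult_distrib real_sqrt_mult)
    moreover have "cis (- (2 * pi * (u + r * x) * \<xi>)) = cis (- (2 * pi * u * \<xi>)) * cis (w * x)"
      by (simp add: cis_mult w_def algebra_simps)
    ultimately show "f (u + r * x) = cis (- (2 * pi * u * \<xi>)) *
        ((1 / r) *\<^sub>R (std_normal_density x *\<^sub>R cis (w * x)))"
      by (simp add: f_def scaleR_conv_of_real)
  qed
  finally have "integral\<^sup>L lborel f = complex_of_real (exp (- (w\<^sup>2) / 2)) * cis (- (2 * pi * u * \<xi>))"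
    using r std by (simp add: scaleR_conv_of_real)
  with has_integral_integral_lborel[OF f_int] show ?thesis
    by (simp add: f_def[abs_def] w_def)
qed

text \<open>Supplies a majorant in t that is uniform over the shifts u, as the exchange of integrals
  demands. With v = (t - u)/r, the ratio (1 + t^2)/(1 + v^2) is bounded in terms of c and r, so the
  decay in v is decay in t.\<close>

lemma normal_density_shift_decay:
  assumes r: "0 < r" and u: "\<bar>u\<bar> \<le> c"
  shows "normal_density 0 r (t - u)
    \<le> (8 / sqrt (2 * pi * r\<^sup>2) * (1 + 2 * c\<^sup>2 + 2 * r\<^sup>2)) / (1 + t\<^sup>2)"
proof -
  define v where "v = (t - u) / r"
  have t: "t = v * r + u" using r by (simp add: v_def)
  have u2: "u\<^sup>2 \<le> c\<^sup>2" using u abs_le_square_iff[of u c] by linarith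
  have "0 \<le> (v * r - u)\<^sup>2" by simp
  then have "1 + t\<^sup>2 \<le> 1 + 2 * r\<^sup>2 * v\<^sup>2 + 2 * c\<^sup>2"
    using u2 by (simp add: t power2_sum power2_diff power_mult_distrib algebra_simps)
  also have "\<dots> \<le> (1 + 2 * c\<^sup>2 + 2 * r\<^sup>2) * (1 + v\<^sup>2)"
    by (simp add: algebra_simps)
  finally have tv: "1 + t\<^sup>2 \<le> (1 + 2 * c\<^sup>2 + 2 * r\<^sup>2) * (1 + v\<^sup>2)" .
  have pos: "0 < 1 + v\<^sup>2" "0 < 1 + t\<^sup>2" by (simp_all add: add_pos_nonneg)
  have "normal_density 0 r (t - u) = 1 / sqrt (2 * pi * r\<^sup>2) * exp (- (v\<^sup>2) / 2)"
    using r by (simp add: normal_density_def v_def power_divide)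
  also have "\<dots> \<le> 1 / sqrt (2 * pi * r\<^sup>2) * (8 / (1 + v\<^sup>2))"
    by (intro mult_left_mono gauss_le) simp
  also have "\<dots> \<le> 1 / sqrt (2 * pi * r\<^sup>2) * (8 * (1 + 2 * c\<^sup>2 + 2 * r\<^sup>2) / (1 + t\<^sup>2))"
  proof (rule mult_left_mono)
    show "8 / (1 + v\<^sup>2) \<le> 8 * (1 + 2 * c\<^sup>2 + 2 * r\<^sup>2) / (1 + t\<^sup>2)"
      using tv pos by (simp add: divide_simps) (simp add: algebra_simps)
  qed simp
  finally show ?thesis
    by (simp add: mult_left_mono)
qed

lemma normal_density_continuous [continuous_intros]:
  assumes "continuous_on S f"
  shows "continuous_on S (\<lambda>x. normal_density m r (f x))"
  unfolding normal_density_def using assms by (cases "r = 0") (auto intro!: continuous_intros)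

lemma fourier_gauss_smoothing:
  fixes F :: "real \<Rightarrow> 'a::complex_banach"
  assumes r: "0 < r" and c: "0 \<le> c" and F: "continuous_on {0..c} F"
  shows "fourier (\<lambda>t. integral {0..c} (\<lambda>u. normal_density 0 r (t - u) *\<^sub>R F u)) \<xi> =
    integral {0..c} (\<lambda>u. (complex_of_real (exp (- ((2 * pi * r * \<xi>)\<^sup>2) / 2)) * cis (- (2 * pi * u * \<xi>))) *\<^sub>C F u)"
proof -
  define k where "k t u = cis (- (2 * pi * t * \<xi>)) * complex_of_real (normal_density 0 r (t - u))" for t u
  define B where "B = 8 / sqrt (2 * pi * r\<^sup>2) * (1 + 2 * c\<^sup>2 + 2 * r\<^sup>2)"
  have k_cont: "continuous_on S (\<lambda>(t, u). k t u)" "continuous_on S (\<lambda>(t, u). k (- t) u)" for S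
    unfolding k_def case_prod_unfold by (intro continuous_intros)+
  have k_le: "cmod (k t u) \<le> B / (1 + (1 * t)\<^sup>2)" if "u \<in> {0..c}" for t u
    using normal_density_shift_decay[OF r, of u c t] that by (simp add: k_def norm_mult B_def)
  have "cis (- (2 * pi * t * \<xi>)) *\<^sub>C integral {0..c} (\<lambda>u. normal_density 0 r (t - u) *\<^sub>R F u)
      = integral {0..c} (\<lambda>u. k t u *\<^sub>C F u)" for t
  proof -
    have "(\<lambda>u. normal_density 0 r (t - u) *\<^sub>R F u) integrable_on {0..c}"
      by (intro integrable_continuous_real continuous_intros F)
    then show ?thesis
      by (simp add: integral_scaleC_right[symmetric] k_def scaleC_scaleC[symmetric] scaleC_of_real)
  qed
  then have "fourier (\<lambda>t. integral {0..c} (\<lambda>u. normal_density 0 r (t - u) *\<^sub>R F u)) \<xi>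
      = integral UNIV (\<lambda>t. integral {0..c} (\<lambda>u. k t u *\<^sub>C F u))"
    by (simp add: fourier_def)
  also have "\<dots> = integral {0..c} (\<lambda>u. (complex_of_real (exp (- ((2 * pi * r * \<xi>)\<^sup>2) / 2)) * cis (- (2 * pi * u * \<xi>))) *\<^sub>C F u)"
  proof (rule integral_unique, rule improper_integral_swap_UNIV(2)[where p = k and q = "\<lambda>t. k (- t)" and \<rho> = 1 and B = B])
    show "((\<lambda>t. k t u) has_integral
        complex_of_real (exp (- ((2 * pi * r * \<xi>)\<^sup>2) / 2)) * cis (- (2 * pi * u * \<xi>))) UNIV" for u
      unfolding k_def by (rule gauss_fourier_scalar[OF r])
    show "cmod (k (- t) u) \<le> B / (1 + (1 * t)\<^sup>2)" if "u \<in> {0..c}" for t u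
      using k_le[OF that, of "- t"] by simp
  qed (use c F k_cont k_le in auto)
  finally show ?thesis .
qed

text \<open>After the exchange of integrals the kernel is the inverse transform of sgn times a
  Gaussian. Pairing the frequencies xi and - xi turns the odd sign into cis(y) - cis(-y) = 2 i
  sin(y), hence into 2i times Dawson's function. Continuity of the kernel is a by-product of the
  exchange.\<close>

lemma inv_fourier_sgn_gauss_smoothing:
  fixes F :: "real \<Rightarrow> 'a::complex_banach"
  assumes r: "0 < r" and c: "0 \<le> c" and F: "continuous_on {0..c} F"
  shows "continuous_on {0..c} (\<lambda>u. dawson (2 * pi * r) (2 * pi * (t - u)))"
    and "inv_fourier (\<lambda>\<xi>. complex_of_real (sgn \<xi>) *\<^sub>C
        fourier (\<lambda>t. integral {0..c} (\<lambda>u. normal_density 0 r (t - u) *\<^sub>R F u)) \<xi>) t =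
      (2 * \<i>) *\<^sub>C integral {0..c} (\<lambda>u. dawson (2 * pi * r) (2 * pi * (t - u)) *\<^sub>R F u)"
proof -
  define E where "E \<xi> = exp (- ((2 * pi * r * \<xi>)\<^sup>2) / 2)" for \<xi>
  define k where "k \<xi> u = complex_of_real (sgn \<xi>) * (complex_of_real (E \<xi>) * cis (2 * pi * (t - u) * \<xi>))" for \<xi> u
  \<comment> \<open>\<open>p\<close> and \<open>q\<close> are \<open>k\<close> on the positive
    half-line and on the reflected negative one, continued continuously to frequency 0, where
    \<open>k\<close> itself is 0.\<close>
  define p where "p \<xi> u = complex_of_real (E \<xi>) * cis (2 * pi * (t - u) * \<xi>)" for \<xi> u
  define q where "q \<xi> u = - (complex_of_real (E \<xi>) * cis (- (2 * pi * (t - u) * \<xi>)))" for \<xi> u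
  define K where "K u = 2 * \<i> * complex_of_real (dawson (2 * pi * r) (2 * pi * (t - u)))" for u
  have E_cont: "continuous_on S E" for S unfolding E_def[abs_def] by (intro continuous_intros) auto
  note E_comp = continuous_on_compose2[OF E_cont[of UNIV] _ subset_UNIV]
  have cont: "continuous_on S (\<lambda>(\<xi>, u). p \<xi> u)" "continuous_on S (\<lambda>(\<xi>, u). q \<xi> u)" for S
    unfolding p_def q_def case_prod_unfold by (intro continuous_intros E_comp)+
  have E_le: "\<bar>E \<xi>\<bar> \<le> 8 / (1 + (2 * pi * r * \<xi>)\<^sup>2)" for \<xi>
    using gauss_le[of "2 * pi * r * \<xi>"] by (simp add: E_def)
  have le: "cmod (p \<xi> u) \<le> 8 / (1 + (2 * pi * r * \<xi>)\<^sup>2)" "cmod (q \<xi> u) \<le> 8 / (1 + (2 * pi * r * \<xi>)\<^sup>2)" for \<xi> u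
    using E_le[of \<xi>] by (simp_all add: p_def q_def norm_mult)
  have K: "((\<lambda>\<xi>. k \<xi> u) has_integral K u) UNIV" for u
  proof -
    have P: "((\<lambda>\<xi>. p \<xi> u) has_integral integral {0..} (\<lambda>\<xi>. p \<xi> u)) {0..}"
      and Q: "((\<lambda>\<xi>. q \<xi> u) has_integral integral {0..} (\<lambda>\<xi>. q \<xi> u)) {0..}"
      using r by (intro improper_integral_dominated(1)[OF _ _ le(1)] improper_integral_dominated(1)[OF _ _ le(2)]
          integrable_continuous_real; auto simp: p_def q_def intro!: continuous_intros E_comp)+
    have "((\<lambda>\<xi>. p \<xi> u + q \<xi> u) has_integral K u) {0..}"
    proof -
      have "((\<lambda>\<xi>. E \<xi> * sin (2 * pi * (t - u) * \<xi>)) has_integral dawson (2 * pi * r) (2 * pi * (t - u))) {0..}"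
        using dawson_has_integral[of "2 * pi * r"] r by (simp add: E_def)
      from has_integral_linear[OF this bounded_linear_compose[OF bounded_linear_mult_right[of "2 * \<i>"] bounded_linear_of_real]]
      have "((\<lambda>\<xi>. 2 * \<i> * complex_of_real (E \<xi> * sin (2 * pi * (t - u) * \<xi>))) has_integral K u) {0..}"
        by (simp add: o_def K_def)
      moreover have "2 * \<i> * complex_of_real (E \<xi> * sin (2 * pi * (t - u) * \<xi>)) = p \<xi> u + q \<xi> u" for \<xi>
        by (simp add: p_def q_def complex_eq_iff)
      ultimately show ?thesis by simp
    qed
    with has_integral_add[OF P Q] have "integral {0..} (\<lambda>\<xi>. p \<xi> u) + integral {0..} (\<lambda>\<xi>. q \<xi> u) = K u"
      using has_integral_unique by blast
    moreover have "((\<lambda>\<xi>. k \<xi> u) has_integral integral {0..} (\<lambda>\<xi>. p \<xi> u) + integral {0..} (\<lambda>\<xi>. q \<xi> u)) UNIV"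
      by (rule has_integral_two_sided[OF P Q]) (simp_all add: k_def p_def q_def E_def)
    ultimately show ?thesis by simp
  qed
  have swap: "continuous_on {0..c} K"
     "((\<lambda>\<xi>. integral {0..c} (\<lambda>u. k \<xi> u *\<^sub>C F u)) has_integral integral {0..c} (\<lambda>u. K u *\<^sub>C F u)) UNIV"
    using r c F cont le K
    by (intro improper_integral_swap_UNIV[where p = p and q = q and k = k and \<rho> = "2 * pi * r" and B = 8 and F = F];
        simp add: k_def p_def q_def E_def)+
  have "continuous_on {0..c} (\<lambda>u. Im (K u) / 2)"
    by (intro continuous_intros swap) auto
  then show dc: "continuous_on {0..c} (\<lambda>u. dawson (2 * pi * r) (2 * pi * (t - u)))"
    by (simp add: K_def)
  have "cis (2 * pi * t * \<xi>) *\<^sub>C (complex_of_real (sgn \<xi>) *\<^sub>C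
        fourier (\<lambda>t. integral {0..c} (\<lambda>u. normal_density 0 r (t - u) *\<^sub>R F u)) \<xi>)
      = integral {0..c} (\<lambda>u. k \<xi> u *\<^sub>C F u)" for \<xi>
  proof -
    have "(\<lambda>u. (complex_of_real (E \<xi>) * cis (- (2 * pi * u * \<xi>))) *\<^sub>C F u) integrable_on {0..c}"
      by (intro integrable_continuous_real continuous_intros F)
    moreover have "k \<xi> u = (cis (2 * pi * t * \<xi>) * complex_of_real (sgn \<xi>)) * (complex_of_real (E \<xi>) * cis (- (2 * pi * u * \<xi>)))" for u
    proof -
      have "cis (2 * pi * (t - u) * \<xi>) = cis (2 * pi * t * \<xi>) * cis (- (2 * pi * u * \<xi>))"
        by (simp add: cis_mult algebra_simps)
      then show ?thesis by (simp add: k_def)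
    qed
    ultimately show ?thesis
      using fourier_gauss_smoothing[OF assms, of \<xi>]
      unfolding scaleC_scaleC E_def[symmetric]
      by (simp add: integral_scaleC_right[symmetric] scaleC_scaleC)
  qed
  then have "inv_fourier (\<lambda>\<xi>. complex_of_real (sgn \<xi>) *\<^sub>C
        fourier (\<lambda>t. integral {0..c} (\<lambda>u. normal_density 0 r (t - u) *\<^sub>R F u)) \<xi>) t
      = integral {0..c} (\<lambda>u. K u *\<^sub>C F u)"
    unfolding inv_fourier_def using integral_unique[OF swap(2)] by simp
  also have "\<dots> = integral {0..c} (\<lambda>u. (2 * \<i>) *\<^sub>C (dawson (2 * pi * r) (2 * pi * (t - u)) *\<^sub>R F u))"
    by (simp add: K_def scaleC_scaleC[symmetric] scaleC_of_real)
  also have "\<dots> = (2 * \<i>) *\<^sub>C integral {0..c} (\<lambda>u. dawson (2 * pi * r) (2 * pi * (t - u)) *\<^sub>R F u)"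
    by (intro integral_scaleC_right integrable_continuous_real continuous_intros dc F)
  finally show "inv_fourier (\<lambda>\<xi>. complex_of_real (sgn \<xi>) *\<^sub>C
        fourier (\<lambda>t. integral {0..c} (\<lambda>u. normal_density 0 r (t - u) *\<^sub>R F u)) \<xi>) t =
      (2 * \<i>) *\<^sub>C integral {0..c} (\<lambda>u. dawson (2 * pi * r) (2 * pi * (t - u)) *\<^sub>R F u)" .
qed

section \<open>The multiplier bound\<close>

text \<open>Let w(t) be the mass that the Gaussian centred at t gives to [0,c]. The smoothed
  function is bounded by M w(t), and w \<le> 1 gives (M w)^2 \<le> M^2 w; by Tonelli w has total
  integral c. The bound is therefore independent of the width r.\<close>

lemma gauss_smoothing_L2:
  fixes F :: "real \<Rightarrow> 'a::complex_banach"
  assumes r: "0 < r" and c: "0 \<le> c" and F: "continuous_on {0..c} F"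
    and M: "\<And>u. u \<in> {0..c} \<Longrightarrow> norm (F u) \<le> M" "0 \<le> M"
  shows "(\<integral>\<^sup>+t. ennreal ((norm (integral {0..c} (\<lambda>u. normal_density 0 r (t - u) *\<^sub>R F u)))\<^sup>2) \<partial>lborel)
    \<le> ennreal (M\<^sup>2 * c)"
proof -
  define w where "w t = integral {0..c} (\<lambda>u. normal_density t r u)" for t
  have nd: "normal_density 0 r (t - u) = normal_density t r u"
    "normal_density t r u = normal_density u r t" for t u
    by (simp_all add: normal_density_def power2_commute)
  have w_int: "normal_density t r integrable_on {0..c}" for t
    by (intro integrable_continuous_real continuous_intros)
  have w_nn: "ennreal (w t) = (\<integral>\<^sup>+u. ennreal (normal_density t r u) * indicator {0..c} u \<partial>lborel)" for t
  proof -
    have "ennreal (w t) = (\<integral>\<^sup>+u. ennreal (indicator {0..c} u * normal_density t r u) \<partial>lborel)"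
      unfolding w_def by (rule nn_integral_has_integral_lebesgue[symmetric, OF _ integrable_integral[OF w_int]]) simp
    also have "\<dots> = (\<integral>\<^sup>+u. ennreal (normal_density t r u) * indicator {0..c} u \<partial>lborel)"
      by (intro nn_integral_cong) (simp split: split_indicator)
    finally show ?thesis .
  qed
  have w0: "0 \<le> w t" for t
    unfolding w_def by (intro integral_nonneg w_int) simp
  have "ennreal (w t) \<le> 1" for t
  proof -
    have "ennreal (w t) \<le> (\<integral>\<^sup>+u. ennreal (normal_density t r u) \<partial>lborel)"
      unfolding w_nn by (intro nn_integral_mono) (simp add: indicator_def)
    also have "\<dots> = ennreal (\<integral>u. normal_density t r u \<partial>lborel)"
      using r by (intro nn_integral_eq_integral) auto
    finally show ?thesis using r by simp
  qed
  then have w1: "w t \<le> 1" for t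
    using ennreal_le_iff[of 1 "w t"] by simp
  have le: "(norm (integral {0..c} (\<lambda>u. normal_density 0 r (t - u) *\<^sub>R F u)))\<^sup>2 \<le> M\<^sup>2 * w t" for t
  proof -
    have "norm (integral {0..c} (\<lambda>u. normal_density 0 r (t - u) *\<^sub>R F u)) \<le>
        integral {0..c} (\<lambda>u. M * normal_density t r u)"
    proof (rule integral_norm_bound_integral)
      show "(\<lambda>u. normal_density 0 r (t - u) *\<^sub>R F u) integrable_on {0..c}"
        by (intro integrable_continuous_real continuous_intros F)
      show "(\<lambda>u. M * normal_density t r u) integrable_on {0..c}"
        by (intro integrable_continuous_real continuous_intros)
      show "norm (normal_density 0 r (t - u) *\<^sub>R F u) \<le> M * normal_density t r u"
        if "u \<in> {0..c}" for u
        using mult_right_mono[OF M(1)[OF that] normal_density_nonneg[of t r u]]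
        by (simp add: nd(1) mult.commute)
    qed
    also have "\<dots> = M * w t" by (simp add: w_def)
    finally have "(norm (integral {0..c} (\<lambda>u. normal_density 0 r (t - u) *\<^sub>R F u)))\<^sup>2 \<le> (M * w t)\<^sup>2"
      by (rule power_mono) simp
    also have "\<dots> \<le> M\<^sup>2 * w t"
      unfolding power_mult_distrib using w0[of t] w1[of t]
      by (intro mult_left_mono) (auto simp: power2_eq_square mult_left_le)
    finally show ?thesis .
  qed
  have [measurable]: "(\<lambda>(t, u). normal_density t r u) \<in> borel_measurable (borel \<Otimes>\<^sub>M borel)"
    unfolding normal_density_def[abs_def] by measurable
  have "(\<integral>\<^sup>+t. ennreal (w t) \<partial>lborel)
      = (\<integral>\<^sup>+t. (\<integral>\<^sup>+u. ennreal (normal_density t r u) * indicator {0..c} u \<partial>lborel) \<partial>lborel)"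
    by (simp add: w_nn)
  also have "\<dots> = (\<integral>\<^sup>+u. (\<integral>\<^sup>+t. ennreal (normal_density t r u) * indicator {0..c} u \<partial>lborel) \<partial>lborel)"
    by (rule lborel_pair.Fubini') measurable
  also have "\<dots> = (\<integral>\<^sup>+u. indicator {0..c} u \<partial>lborel)"
  proof (intro nn_integral_cong)
    fix u
    have "(\<integral>\<^sup>+t. ennreal (normal_density t r u) \<partial>lborel) = (\<integral>\<^sup>+t. ennreal (normal_density u r t) \<partial>lborel)"
      by (simp add: nd(2)[of _ u])
    also have "\<dots> = ennreal (\<integral>t. normal_density u r t \<partial>lborel)"
      using r by (intro nn_integral_eq_integral) auto
    finally have "(\<integral>\<^sup>+t. ennreal (normal_density t r u) \<partial>lborel) = 1" using r by simp
    then show "(\<integral>\<^sup>+t. ennreal (normal_density t r u) * indicator {0..c} u \<partial>lborel) = indicator {0..c} u"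
      by (subst nn_integral_multc) (auto simp: normal_density_def)
  qed
  also have "\<dots> = ennreal c" using c by simp
  finally have w_total: "(\<integral>\<^sup>+t. ennreal (w t) \<partial>lborel) = ennreal c" .
  have [measurable]: "(\<lambda>t. ennreal (w t)) \<in> borel_measurable lborel"
    unfolding w_nn by measurable
  have "(\<integral>\<^sup>+t. ennreal ((norm (integral {0..c} (\<lambda>u. normal_density 0 r (t - u) *\<^sub>R F u)))\<^sup>2) \<partial>lborel)
      \<le> (\<integral>\<^sup>+t. ennreal (M\<^sup>2) * ennreal (w t) \<partial>lborel)"
    using le w0 by (intro nn_integral_mono) (simp add: ennreal_mult[symmetric] ennreal_leI)
  also have "\<dots> = ennreal (M\<^sup>2 * c)"
    using c by (simp add: nn_integral_cmult w_total ennreal_mult)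
  finally show ?thesis .
qed

text \<open>The point is the order of quantifiers: \<open>A\<close> is fixed before the width, the
  interval and the function, since both the multiplier constant and the bound on the smoothed
  function are free of r.\<close>

lemma UMD_dawson_L2_bound:
  assumes "UMD TYPE('a::complex_banach)"
  obtains A where "0 \<le> A"
    "\<And>r c F M. 0 < r \<Longrightarrow> 0 \<le> c \<Longrightarrow> continuous_on {0..c} F \<Longrightarrow>
      (\<And>u. u \<in> {0..c} \<Longrightarrow> norm (F u :: 'a) \<le> M) \<Longrightarrow> 0 \<le> M \<Longrightarrow>
      (\<integral>\<^sup>+t. ennreal ((norm (integral {0..c} (\<lambda>u. dawson (2 * pi * r) (2 * pi * (t - u)) *\<^sub>R F u)))\<^sup>2) \<partial>lborel)
        \<le> ennreal (A * M\<^sup>2 * c)"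
proof -
  from assms obtain C :: real where C: "\<And>f :: real \<Rightarrow> 'a. schwartz f \<Longrightarrow>
        (\<integral>\<^sup>+t. ennreal ((norm (inv_fourier (\<lambda>\<xi>. complex_of_real (sgn \<xi>) *\<^sub>C fourier f \<xi>) t))\<^sup>2) \<partial>lborel)
          \<le> ennreal (C\<^sup>2) * (\<integral>\<^sup>+t. ennreal ((norm (f t))\<^sup>2) \<partial>lborel)"
    unfolding UMD_def bounded_L2_fourier_multiplier_def by auto
  show thesis
  proof (rule that[of "C\<^sup>2"])
    fix r c M :: real and F :: "real \<Rightarrow> 'a"
    assume r: "0 < r" and c: "0 \<le> c" and F: "continuous_on {0..c} F"
      and M: "\<And>u. u \<in> {0..c} \<Longrightarrow> norm (F u) \<le> M" "0 \<le> M"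
    let ?D = "\<lambda>t. integral {0..c} (\<lambda>u. dawson (2 * pi * r) (2 * pi * (t - u)) *\<^sub>R F u)"
    let ?f = "\<lambda>t. integral {0..c} (\<lambda>u. normal_density 0 r (t - u) *\<^sub>R F u)"
    \<comment> \<open>The multiplier returns 2i times \<open>?D\<close>; the resulting factor 4 on
      the right is dropped.\<close>
    have "(\<integral>\<^sup>+t. ennreal ((norm (?D t))\<^sup>2) \<partial>lborel)
        \<le> (\<integral>\<^sup>+t. ennreal ((norm (inv_fourier (\<lambda>\<xi>. complex_of_real (sgn \<xi>) *\<^sub>C fourier ?f \<xi>) t))\<^sup>2) \<partial>lborel)"
      by (intro nn_integral_mono ennreal_leI)
        (simp add: inv_fourier_sgn_gauss_smoothing(2)[OF r c F] norm_scaleC norm_mult power_mult_distrib)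
    also have "\<dots> \<le> ennreal (C\<^sup>2) * (\<integral>\<^sup>+t. ennreal ((norm (?f t))\<^sup>2) \<partial>lborel)"
      by (intro C schwartz_gauss_smoothing r c F)
    also have "\<dots> \<le> ennreal (C\<^sup>2) * ennreal (M\<^sup>2 * c)"
      by (intro mult_left_mono gauss_smoothing_L2 r c F M) auto
    also have "\<dots> = ennreal (C\<^sup>2 * M\<^sup>2 * c)"
      using c by (simp add: ennreal_mult[symmetric] mult.assoc)
    finally show "(\<integral>\<^sup>+t. ennreal ((norm (?D t))\<^sup>2) \<partial>lborel) \<le> ennreal (C\<^sup>2 * M\<^sup>2 * c)" .
  qed simp
qed

section \<open>Transference to semigroups\<close>

text \<open>Baire: if every open set \<open>G n\<close> were dense, their intersection would be
  dense as well, but pointwise boundedness makes it empty. So some ball misses some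
  \<open>G n\<close>, and translating and scaling this ball gives the operator bound.\<close>

lemma uniform_boundedness_principle:
  fixes T :: "'i \<Rightarrow> 'a::banach \<Rightarrow> 'b::real_normed_vector"
  assumes lin: "\<And>i. i \<in> I \<Longrightarrow> bounded_linear (T i)"
    and bdd: "\<And>x. bounded ((\<lambda>i. T i x) ` I)"
  obtains M where "0 \<le> M" "\<And>i x. i \<in> I \<Longrightarrow> norm (T i x) \<le> M * norm x"
proof -
  define G where "G n = {x. \<exists>i\<in>I. real n < norm (T i x)}" for n
  have G_open: "open (G n)" for n
  proof -
    have "G n = (\<Union>i\<in>I. {x. real n < norm (T i x)})" by (auto simp: G_def)
    moreover have "open {x. real n < norm (T i x)}" if "i \<in> I" for i
      by (intro open_Collect_less continuous_intros linear_continuous_on[OF lin[OF that]])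
    ultimately show ?thesis by auto
  qed
  have "(\<Inter>n. G n) = {}"
  proof (rule ccontr)
    assume "(\<Inter>n. G n) \<noteq> {}"
    then obtain x where x: "\<And>n. x \<in> G n" by auto
    obtain B where B: "\<And>i. i \<in> I \<Longrightarrow> norm (T i x) \<le> B"
      using bdd[of x] by (auto simp: bounded_iff)
    obtain n :: nat where "B \<le> real n" using real_arch_simple by blast
    then show False using x[of n] B by (force simp: G_def)
  qed
  moreover have "closure (\<Inter>n. G n) = UNIV" if "\<And>n. closure (G n) = UNIV"
  proof -
    have "Met_TC.mtopology closure_of \<Inter>(range G) = UNIV"
      by (rule Met_TC.metric_Baire_category)
        (auto simp: G_open that euclidean_closure_of complete_UNIV)
    then show ?thesis by (simp add: euclidean_closure_of)
  qed
  ultimately obtain n where "closure (G n) \<noteq> UNIV" by fastforce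
  then obtain x0 where "x0 \<notin> closure (G n)" by auto
  then obtain e where e: "e > 0" "\<And>y. dist y x0 < e \<Longrightarrow> y \<notin> G n"
    unfolding closure_approachable by blast
  have "norm (T i x) \<le> 4 * real n / e * norm x" if i: "i \<in> I" for i x
  proof (cases "x = 0")
    case True
    then show ?thesis using linear_0[OF bounded_linear.linear[OF lin[OF i]]] by simp
  next
    case False
    interpret bounded_linear "T i" by (rule lin[OF i])
    \<comment> \<open>The scaling puts x0 + k x at distance e/2 from x0; comparing the values at
      both points costs 2 n, whence the constant 2 n / k = 4 n norm x / e.\<close>
    define k where "k = e / (2 * norm x)"
    have k: "k > 0" using False e(1) by (simp add: k_def)
    have "norm (k *\<^sub>R x) < e" using False e(1) by (simp add: k_def)
    then have "norm (T i (x0 + k *\<^sub>R x)) \<le> real n" "norm (T i x0) \<le> real n"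
      using e(2)[of "x0 + k *\<^sub>R x"] e(2)[of x0] e(1) i by (force simp: G_def dist_norm)+
    then have "norm (T i (x0 + k *\<^sub>R x) - T i x0) \<le> 2 * real n"
      using norm_triangle_ineq4[of "T i (x0 + k *\<^sub>R x)" "T i x0"] by linarith
    then have "k * norm (T i x) \<le> 2 * real n"
      using k by (simp add: add scaleR)
    then show ?thesis using k False e(1) by (simp add: k_def field_simps)
  qed
  moreover have "0 \<le> 4 * real n / e" using e(1) by simp
  ultimately show thesis using that by blast
qed

text \<open>Folding at the centre pairs p + v with p - v, so that an odd kernel such as 1/(u - p)
  becomes a difference of orbit values, the form in which the cancellation is visible.\<close>

lemma has_integral_symmetric_annulus:
  fixes f :: "real \<Rightarrow> 'b::banach"
  assumes r: "0 < r"
    and plus: "(\<lambda>v. f (p + v)) integrable_on {r..a}"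
    and minus: "(\<lambda>v. f (p - v)) integrable_on {r..a}"
  shows "(f has_integral integral {r..a} (\<lambda>v. f (p + v) + f (p - v))) {u. r \<le> \<bar>u - p\<bar> \<and> \<bar>u - p\<bar> \<le> a}"
proof -
  have "(f has_integral integral {r..a} (\<lambda>v. f (p + v))) {r + p..a + p}"
    using integrable_integral[OF plus] has_integral_shift_Icc_real[of f p _ r a] by (simp add: o_def)
  moreover have "(f has_integral integral {r..a} (\<lambda>v. f (p - v))) {- a + p..- r + p}"
    using integrable_integral[OF minus] has_integral_shift_Icc_real[of f p _ "- a" "- r"]
      has_integral_reflect_real[of "\<lambda>v. f (p + v)" _ "- r" "- a"] by (simp add: o_def)
  moreover have "{r + p..a + p} \<inter> {- a + p..- r + p} = {}" using r by auto
  moreover have "{r + p..a + p} \<union> {- a + p..- r + p} = {u. r \<le> \<bar>u - p\<bar> \<and> \<bar>u - p\<bar> \<le> a}"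
    using r by (auto simp: abs_if split: if_splits)
  ultimately have "(f has_integral integral {r..a} (\<lambda>v. f (p + v)) + integral {r..a} (\<lambda>v. f (p - v)))
      {u. r \<le> \<bar>u - p\<bar> \<and> \<bar>u - p\<bar> \<le> a}"
    using has_integral_Un[of f _ "{r + p..a + p}" _ "{- a + p..- r + p}"] by simp
  then show ?thesis by (simp add: integral_add[OF plus minus])
qed

text \<open>A sum, not a difference: the truncated integral carries 1/(u - p), the convolution a
  kernel close to 1/(p - u). Replacing Dawson's kernel by the one truncated at r costs the integral
  of 8 pi r/(r^2 + s^2), at most 8 pi^2; discarding |u - p| > a costs at most 1/a on an interval of
  length c.\<close>

lemma truncated_hilbert_dawson_diff:
  fixes F :: "real \<Rightarrow> 'a::complex_banach"
  assumes r: "0 < r" "r \<le> a" and p: "a \<le> p" "p + a \<le> c"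
    and F: "continuous_on {0..c} F"
    and dc: "continuous_on {0..c} (\<lambda>u. dawson (2 * pi * r) (2 * pi * (p - u)))"
    and M: "\<And>u. u \<in> {0..c} \<Longrightarrow> norm (F u) \<le> M" "0 \<le> M"
  shows "norm (integral {r..a} (\<lambda>v. (1 / v) *\<^sub>R (F (p + v) - F (p - v))) +
      (2 * pi) *\<^sub>R integral {0..c} (\<lambda>u. dawson (2 * pi * r) (2 * pi * (p - u)) *\<^sub>R F u))
    \<le> (8 * pi\<^sup>2 + c / a) * M"
proof -
  let ?S = "{u. r \<le> \<bar>u - p\<bar> \<and> \<bar>u - p\<bar> \<le> a}"
  define d where "d u = dawson (2 * pi * r) (2 * pi * (p - u))" for u
  define f where "f u = (1 / (u - p)) *\<^sub>R F u" for u
  define h where "h u = (if u \<in> ?S then f u else 0)" for u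
  define W where "W = integral {r..a} (\<lambda>v. (1 / v) *\<^sub>R (F (p + v) - F (p - v)))"
  have a: "0 < a" and c: "0 \<le> c" using r p by auto
  have "(f has_integral integral {r..a} (\<lambda>v. f (p + v) + f (p - v))) ?S"
    unfolding f_def using r p
    by (intro has_integral_symmetric_annulus integrable_continuous_real continuous_intros
        continuous_on_compose2[OF F]) auto
  also have "(\<lambda>v. f (p + v) + f (p - v)) = (\<lambda>v. (1 / v) *\<^sub>R (F (p + v) - F (p - v)))"
    by (auto simp: f_def scaleR_diff_right)
  finally have h_int: "(h has_integral W) {0..c}"
    unfolding h_def W_def using p by (subst has_integral_restrict) auto
  have d_int: "((\<lambda>u. d u *\<^sub>R F u) has_integral integral {0..c} (\<lambda>u. d u *\<^sub>R F u)) {0..c}"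
    unfolding d_def by (intro integrable_integral integrable_continuous_real continuous_intros dc F)
  have sum_int: "((\<lambda>u. h u + (2 * pi) *\<^sub>R (d u *\<^sub>R F u)) has_integral
      W + (2 * pi) *\<^sub>R integral {0..c} (\<lambda>u. d u *\<^sub>R F u)) {0..c}"
    by (intro has_integral_add h_int has_integral_cmul d_int)
  define m where "m u = (8 * pi * r / (r\<^sup>2 + (p - u)\<^sup>2) + 1 / a) * M" for u
  have le: "norm (h u + (2 * pi) *\<^sub>R (d u *\<^sub>R F u)) \<le> m u" if u: "u \<in> {0..c}" for u
  proof -
    \<comment> \<open>\<open>tr\<close> is truncated near p only, \<open>k\<close> also at distance
      a; they differ only where |p - u| > a, and there by at most 1/a.\<close>
    define tr where "tr = (if r \<le> \<bar>p - u\<bar> then 1 / (p - u) else 0)"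
    define k where "k = (if u \<in> ?S then 1 / (p - u) else 0)"
    have "1 / (u - p) = - (1 / (p - u))" by (metis minus_diff_eq minus_divide_right)
    then have "h u = - (k *\<^sub>R F u)" by (simp add: h_def k_def f_def)
    then have "h u + (2 * pi) *\<^sub>R (d u *\<^sub>R F u) = (2 * pi * d u - k) *\<^sub>R F u"
      by (simp add: scaleR_diff_left)
    moreover have "\<bar>2 * pi * d u - tr\<bar> \<le> 8 * pi * r / (r\<^sup>2 + (p - u)\<^sup>2)"
      unfolding d_def tr_def by (rule dawson_minus_truncated_le[OF r(1)])
    moreover have "\<bar>tr - k\<bar> \<le> 1 / a"
    proof (cases "a < \<bar>p - u\<bar>")
      case True
      then have "k = 0" "tr = 1 / (p - u)" using r by (auto simp: k_def tr_def)
      then show ?thesis using True a by (simp add: frac_le)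
    next
      case False
      then have "k = tr" by (simp add: k_def tr_def abs_minus_commute)
      then show ?thesis using a by simp
    qed
    ultimately have "\<bar>2 * pi * d u - k\<bar> \<le> 8 * pi * r / (r\<^sup>2 + (p - u)\<^sup>2) + 1 / a"
      by linarith
    then have "\<bar>2 * pi * d u - k\<bar> * norm (F u) \<le> m u"
      unfolding m_def by (intro mult_mono M(1)[OF u]) auto
    then show ?thesis
      using \<open>h u + (2 * pi) *\<^sub>R (d u *\<^sub>R F u) = (2 * pi * d u - k) *\<^sub>R F u\<close> by simp
  qed
  have "(m has_integral (8 * pi * arctan ((c - p) / r) + c / a) * M - (8 * pi * arctan ((0 - p) / r) + 0 / a) * M) {0..c}"
  proof (rule fundamental_theorem_of_calculus[OF c])
    fix u
    have sq: "r\<^sup>2 + (p - u)\<^sup>2 \<noteq> 0" "1 + ((u - p) / r)\<^sup>2 \<noteq> 0"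
      using r by (simp_all add: add_pos_nonneg pos_add_strict less_imp_neq[symmetric])
    have *: "inverse (1 + ((u - p) / r)\<^sup>2) / r = r / (r\<^sup>2 + (p - u)\<^sup>2)"
      using r sq by (simp add: divide_simps power2_commute[of u p]) (simp add: power2_eq_square algebra_simps)
    have "((\<lambda>u. (8 * pi * arctan ((u - p) / r) + u / a) * M) has_real_derivative
        (8 * pi * (inverse (1 + ((u - p) / r)\<^sup>2) / r) + 1 / a) * M) (at u within {0..c})"
      using r a by (auto intro!: derivative_eq_intros)
    then show "((\<lambda>u. (8 * pi * arctan ((u - p) / r) + u / a) * M) has_vector_derivative m u) (at u within {0..c})"
      unfolding * m_def has_real_derivative_iff_has_vector_derivative by simp
  qed
  note m_int = this
  have "norm (W + (2 * pi) *\<^sub>R integral {0..c} (\<lambda>u. d u *\<^sub>R F u)) \<le> integral {0..c} m"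
    unfolding integral_unique[OF sum_int, symmetric]
    using le by (intro integral_norm_bound_integral) (use sum_int m_int in auto)
  also have "integral {0..c} m = (8 * pi * (arctan ((c - p) / r) - arctan ((0 - p) / r)) + c / a) * M"
    using integral_unique[OF m_int] by (simp add: algebra_simps)
  \<comment> \<open>The two arctan values differ by at most pi whatever r is: this is where the
    estimate becomes uniform in the truncation.\<close>
  also have "\<dots> \<le> (8 * pi * (pi / 2 - - (pi / 2)) + c / a) * M"
    using arctan_ubound[of "(c - p) / r"] arctan_lbound[of "(0 - p) / r"] M(2)
    by (intro mult_right_mono add_right_mono mult_left_mono diff_mono) auto
  also have "\<dots> = (8 * pi\<^sup>2 + c / a) * M" by (simp add: power2_eq_square)
  finally show ?thesis by (simp add: W_def d_def)
qed

section \<open>Basic properties of strongly continuous semigroups\<close>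

lemma C0_semigroupD:
  assumes "C0_semigroup T"
  shows "0 \<le> s \<Longrightarrow> bounded_linear (T s)" and "T 0 x = x"
    and "0 \<le> s \<Longrightarrow> 0 \<le> t \<Longrightarrow> T (s + t) x = T s (T t x)"
    and "continuous_on {0..} (\<lambda>s. T s x)"
  using assms by (auto simp: C0_semigroup_def bounded_clinear_def)

text \<open>Each orbit is bounded on the compact interval by continuity; uniform boundedness makes
  the bound uniform in x. The normalisation 1 \<le> M allows division by M later.\<close>

lemma C0_semigroup_locally_bounded:
  assumes T: "C0_semigroup T"
  shows "\<exists>M\<ge>1. \<forall>s\<in>{0..c}. \<forall>x. norm (T s x) \<le> M * norm x"
proof -
  have "bounded ((\<lambda>s. T s x) ` {0..c})" for x
    by (intro compact_imp_bounded compact_continuous_image continuous_on_subset[OF C0_semigroupD(4)[OF T]]) auto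
  then obtain M where M: "0 \<le> M" "\<And>s x. s \<in> {0..c} \<Longrightarrow> norm (T s x) \<le> M * norm x"
    using uniform_boundedness_principle[of "{0..c}" T] C0_semigroupD(1)[OF T] by auto
  have "norm (T s x) \<le> max 1 M * norm x" if "s \<in> {0..c}" for s x
    using order_trans[OF M(2)[OF that, of x] mult_right_mono[of M "max 1 M" "norm x"]] by simp
  then show ?thesis by (intro exI[of _ "max 1 M"]) auto
qed

text \<open>Transference: \<open>T(b+v) = T(t) T(p+v)\<close> with \<open>p = b - t\<close>, so the truncated integral
  centred at \<open>b\<close> is \<open>T(t)\<close> applied to the truncated Hilbert transform at \<open>p\<close> of the orbit of
  \<open>x\<close>, for each \<open>p\<close> in \<open>[a,b]\<close>; the \<open>L\<^sup>2\<close> bound controls the latter for some such \<open>p\<close>.\<close>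
lemma truncated_semigroup_bound:
  fixes T :: "real \<Rightarrow> 'a::complex_banach \<Rightarrow> 'a"
  assumes umd: "UMD TYPE('a)" and T: "C0_semigroup T" and ab: "0 < a" "a < b"
  obtains K where "0 \<le> K" "\<And>r x. 0 < r \<Longrightarrow> r \<le> a \<Longrightarrow>
      norm (integral {r..a} (\<lambda>v. (1 / v) *\<^sub>R (T (b + v) x - T (b - v) x))) \<le> K * norm x"
proof (rule UMD_dawson_L2_bound[OF umd])
  fix A :: real
  assume A: "0 \<le> A"
    "\<And>r c F M. 0 < r \<Longrightarrow> 0 \<le> c \<Longrightarrow> continuous_on {0..c} F \<Longrightarrow>
      (\<And>u. u \<in> {0..c} \<Longrightarrow> norm (F u :: 'a) \<le> M) \<Longrightarrow> 0 \<le> M \<Longrightarrow>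
      (\<integral>\<^sup>+t. ennreal ((norm (integral {0..c} (\<lambda>u. dawson (2 * pi * r) (2 * pi * (t - u)) *\<^sub>R F u)))\<^sup>2) \<partial>lborel)
        \<le> ennreal (A * M\<^sup>2 * c)"
  define c where "c = b + a"
  have c: "0 \<le> c" using ab by (simp add: c_def)
  obtain M where M: "1 \<le> M" "\<And>s x. s \<in> {0..c} \<Longrightarrow> norm (T s x) \<le> M * norm x"
    using C0_semigroup_locally_bounded[OF T, of c] by auto
  \<comment> \<open>Read off backwards: the final inequality for \<open>\<mu>\<close> below, solved
    for the norm of \<open>U\<close>.\<close>
  define K where "K = M * ((8 * pi\<^sup>2 + c / a) * M + 2 * pi * (sqrt (A * c / (b - a)) * M))"
  show thesis
  proof (rule that[of K])
    show "0 \<le> K" using M(1) A(1) ab c by (simp add: K_def)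
    fix r x assume r: "0 < r" "r \<le> a"
    define U where "U = integral {r..a} (\<lambda>v. (1 / v) *\<^sub>R (T (b + v) x - T (b - v) x))"
    define J where "J p = integral {0..c} (\<lambda>u. dawson (2 * pi * r) (2 * pi * (p - u)) *\<^sub>R T u x)" for p
    define N where "N = M * norm x"
    have N: "\<And>u. u \<in> {0..c} \<Longrightarrow> norm (T u x) \<le> N" "0 \<le> N"
      using M by (auto simp: N_def)
    have F: "continuous_on {0..c} (\<lambda>u. T u x)"
      by (rule continuous_on_subset[OF C0_semigroupD(4)[OF T]]) auto
    have J_L2: "(\<integral>\<^sup>+p. ennreal ((norm (J p))\<^sup>2) \<partial>lborel) \<le> ennreal (A * N\<^sup>2 * c)"
      unfolding J_def by (rule A(2)[OF r(1) c F N])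
    \<comment> \<open>The lower bound for the norm of \<open>J p\<close> that a given norm of
      \<open>U\<close> forces at every centre p; it does not depend on p and may be
      negative.\<close>
    define \<mu> where "\<mu> = (norm U / M - (8 * pi\<^sup>2 + c / a) * N) / (2 * pi)"
    \<comment> \<open>p \<le> b makes b - p an admissible time, and a \<le> p keeps p - v
      nonnegative for all v up to a.\<close>
    have J_ge: "\<mu> \<le> norm (J p)" if p: "p \<in> {a..b}" for p
    proof -
      define W where "W = integral {r..a} (\<lambda>v. (1 / v) *\<^sub>R (T (p + v) x - T (p - v) x))"
      interpret T: bounded_linear "T (b - p)" using p by (intro C0_semigroupD(1)[OF T]) auto
      have "(\<lambda>v. (1 / v) *\<^sub>R (T (p + v) x - T (p - v) x)) integrable_on {r..a}"
      proof (intro integrable_continuous_real continuous_on_scaleR continuous_on_diff)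
        show "continuous_on {r..a} (\<lambda>v. T (p + v) x)"
          by (rule continuous_on_compose2[OF C0_semigroupD(4)[OF T, of x], where f = "\<lambda>v. p + v"])
            (use r p in \<open>auto intro!: continuous_intros\<close>)
        show "continuous_on {r..a} (\<lambda>v. T (p - v) x)"
          by (rule continuous_on_compose2[OF C0_semigroupD(4)[OF T, of x], where f = "\<lambda>v. p - v"])
            (use r p in \<open>auto intro!: continuous_intros\<close>)
        show "continuous_on {r..a} (\<lambda>v. 1 / v)"
          using r by (auto intro!: continuous_intros)
      qed
      from integral_linear[OF this T.bounded_linear_axioms]
      have "T (b - p) W = integral {r..a} (\<lambda>v. T (b - p) ((1 / v) *\<^sub>R (T (p + v) x - T (p - v) x)))"
        unfolding W_def o_def by (rule sym)
      also have "\<dots> = U" unfolding U_def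
      proof (rule integral_cong)
        fix v assume v: "v \<in> {r..a}"
        have "T (b + v) x = T (b - p) (T (p + v) x)" "T (b - v) x = T (b - p) (T (p - v) x)"
          using v p r C0_semigroupD(3)[OF T, of "b - p" "p + v" x] C0_semigroupD(3)[OF T, of "b - p" "p - v" x]
          by auto
        then show "T (b - p) ((1 / v) *\<^sub>R (T (p + v) x - T (p - v) x)) = (1 / v) *\<^sub>R (T (b + v) x - T (b - v) x)"
          by (simp only: T.scaleR T.diff)
      qed
      finally have "norm U \<le> M * norm W"
        using M(2)[of "b - p" W] p ab by (simp add: c_def)
      then have "norm U / M \<le> norm W" using M(1) by (simp add: pos_divide_le_eq mult.commute)
      moreover have "norm (W + (2 * pi) *\<^sub>R J p) \<le> (8 * pi\<^sup>2 + c / a) * N"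
        unfolding W_def J_def using p inv_fourier_sgn_gauss_smoothing(1)[OF r(1) c F]
        by (intro truncated_hilbert_dawson_diff r F N) (auto simp: c_def)
      moreover have "norm W \<le> norm (W + (2 * pi) *\<^sub>R J p) + 2 * pi * norm (J p)"
        using norm_triangle_ineq4[of "W + (2 * pi) *\<^sub>R J p" "(2 * pi) *\<^sub>R J p"] by simp
      ultimately have "norm U / M - (8 * pi\<^sup>2 + c / a) * N \<le> norm (J p) * (2 * pi)"
        by (simp add: mult.commute)
      then show ?thesis by (simp add: \<mu>_def pos_divide_le_eq)
    qed
    have "\<mu> \<le> sqrt (A * c / (b - a)) * N"
    proof (cases "0 \<le> \<mu>")
      case True
      \<comment> \<open>Integrating the constant lower bound over the centres p in [a,b] and
        comparing with the L^2 bound; dividing by b - a uses a < b.\<close>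
      have "ennreal (\<mu>\<^sup>2 * (b - a)) = (\<integral>\<^sup>+p. ennreal (\<mu>\<^sup>2) * indicator {a..b} p \<partial>lborel)"
        using ab by (simp add: nn_integral_cmult_indicator ennreal_mult)
      also have "\<dots> \<le> (\<integral>\<^sup>+p. ennreal ((norm (J p))\<^sup>2) \<partial>lborel)"
        using J_ge True by (intro nn_integral_mono) (auto simp: indicator_def intro!: ennreal_leI power_mono)
      also note J_L2
      finally have "\<mu>\<^sup>2 * (b - a) \<le> A * N\<^sup>2 * c"
        using A(1) c by (simp add: ennreal_le_iff)
      then have "\<mu>\<^sup>2 \<le> A * N\<^sup>2 * c / (b - a)"
        using ab by (simp add: pos_le_divide_eq)
      also have "\<dots> = (sqrt (A * c / (b - a)) * N)\<^sup>2"
        using A(1) c ab by (simp add: power_mult_distrib)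
      finally show ?thesis
        by (rule power2_le_imp_le) (use A(1) c ab N(2) in simp)
    next
      case False
      moreover have "0 \<le> sqrt (A * c / (b - a)) * N" using A(1) c ab N(2) by simp
      ultimately show ?thesis by linarith
    qed
    then have "2 * pi * \<mu> \<le> 2 * pi * (sqrt (A * c / (b - a)) * N)"
      by (intro mult_left_mono) auto
    moreover have "2 * pi * \<mu> = norm U / M - (8 * pi\<^sup>2 + c / a) * N" by (simp add: \<mu>_def)
    ultimately have "norm U / M \<le> (8 * pi\<^sup>2 + c / a) * N + 2 * pi * (sqrt (A * c / (b - a)) * N)"
      by linarith
    then have "M * (norm U / M) \<le> M * ((8 * pi\<^sup>2 + c / a) * N + 2 * pi * (sqrt (A * c / (b - a)) * N))"
      using M(1) by (intro mult_left_mono) auto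
    moreover have "M * (norm U / M) = norm U" using M(1) by simp
    moreover have "M * ((8 * pi\<^sup>2 + c / a) * N + 2 * pi * (sqrt (A * c / (b - a)) * N)) = K * norm x"
      unfolding K_def N_def by (simp only: distrib_right mult.assoc)
    ultimately show "norm (integral {r..a} (\<lambda>v. (1 / v) *\<^sub>R (T (b + v) x - T (b - v) x))) \<le> K * norm x"
      by (simp only: U_def)
  qed
qed

section \<open>Weights of bounded variation\<close>

text \<open>\<open>V s\<close> is the total variation of \<open>g\<close> on [c,s]. Afterwards
  \<open>g\<close> is used only through the increments of this function, which add up over adjacent
  intervals.\<close>

lemma BV_on_variation:
  assumes g: "BV_on c d g"
  obtains V where "\<And>s t. c \<le> s \<Longrightarrow> s \<le> t \<Longrightarrow> t \<le> d \<Longrightarrow> cmod (g t - g s) \<le> V t - V s"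
proof -
  define P where "P s = {(\<Sum>i<n. cmod (g (t (Suc i)) - g (t i))) | n (t :: nat \<Rightarrow> real).
      mono_on {..n} t \<and> t ` {..n} \<subseteq> {c..s}}" for s
  obtain M where M: "\<And>n t. mono_on {..n} t \<Longrightarrow> t ` {..n} \<subseteq> {c..d} \<Longrightarrow>
      (\<Sum>i<n. cmod (g (t (Suc i)) - g (t i))) \<le> M"
    using g unfolding BV_on_def by blast
  have bdd: "bdd_above (P s)" if "s \<le> d" for s
  proof (rule bdd_aboveI)
    fix x assume "x \<in> P s"
    then obtain n t where "mono_on {..n} t" "t ` {..n} \<subseteq> {c..s}"
      and x: "x = (\<Sum>i<n. cmod (g (t (Suc i)) - g (t i)))"
      unfolding P_def by blast
    moreover from this that have "t ` {..n} \<subseteq> {c..d}" by fastforce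
    ultimately show "x \<le> M" using M by simp
  qed
  have ne: "0 \<in> P s" if "c \<le> s" for s
    unfolding P_def using that by (auto intro!: exI[of _ 0] exI[of _ "\<lambda>_. c"] simp: mono_on_def)
  show thesis
  proof (rule that[of "\<lambda>s. Sup (P s)"])
    fix s t assume st: "c \<le> s" "s \<le> t" "t \<le> d"
    have "Sup (P s) \<le> Sup (P t) - cmod (g t - g s)"
    proof (rule cSup_least)
      show "P s \<noteq> {}" using ne st by auto
      fix x assume "x \<in> P s"
      then obtain n \<tau> where \<tau>: "mono_on {..n} \<tau>" "\<tau> ` {..n} \<subseteq> {c..s}"
        and x: "x = (\<Sum>i<n. cmod (g (\<tau> (Suc i)) - g (\<tau> i)))"
        unfolding P_def by blast
      \<comment> \<open>A partition of [c,s] is prolonged by the two points s and t; it need not end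
        at s, and the extra jump from its last point to s is nonnegative and may be dropped.\<close>
      define \<sigma> where "\<sigma> i = (if i \<le> n then \<tau> i else if i = Suc n then s else t)" for i
      have \<tau>_le: "\<tau> i \<in> {c..s}" if "i \<le> n" for i using \<tau>(2) that by auto
      have "mono_on {..n + 2} \<sigma>"
        unfolding mono_on_def
      proof (intro allI impI, elim conjE)
        fix i j :: nat assume ij: "i \<le> j"
        show "\<sigma> i \<le> \<sigma> j"
          using ij \<tau>_le[of i] mono_onD[OF \<tau>(1), of i j] st
          by (cases "i \<le> n"; cases "j \<le> n") (auto simp: \<sigma>_def)
      qed
      moreover have "\<sigma> ` {..n + 2} \<subseteq> {c..t}"
      proof (rule image_subsetI)
        fix i show "\<sigma> i \<in> {c..t}"
          using \<tau>_le[of i] st by (cases "i \<le> n") (auto simp: \<sigma>_def)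
      qed
      ultimately have "(\<Sum>i<n + 2. cmod (g (\<sigma> (Suc i)) - g (\<sigma> i))) \<in> P t"
        unfolding P_def by (intro CollectI exI[of _ "n + 2"] exI[of _ \<sigma>]) simp
      then have "(\<Sum>i<n + 2. cmod (g (\<sigma> (Suc i)) - g (\<sigma> i))) \<le> Sup (P t)"
        using bdd st by (intro cSup_upper) auto
      moreover have "(\<Sum>i<n + 2. cmod (g (\<sigma> (Suc i)) - g (\<sigma> i)))
          = x + cmod (g s - g (\<tau> n)) + cmod (g t - g s)"
        by (simp add: x \<sigma>_def)
      ultimately show "x \<le> Sup (P t) - cmod (g t - g s)"
        using norm_ge_zero[of "g s - g (\<tau> n)"] by linarith
    qed
    then show "cmod (g t - g s) \<le> Sup (P t) - Sup (P s)" by linarith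
  qed
qed

text \<open>Jordan decomposition: for h the real or imaginary part of \<open>g\<close>, both h + V
  and V are monotone, and monotone functions are integrable.\<close>

lemma integrable_of_variation:
  fixes g :: "real \<Rightarrow> complex"
  assumes V: "\<And>s t. c \<le> s \<Longrightarrow> s \<le> t \<Longrightarrow> t \<le> d \<Longrightarrow> cmod (g t - g s) \<le> V t - V s"
  shows "g integrable_on {c..d}"
proof -
  have V_int: "V integrable_on {c..d}"
  proof (rule integrable_on_mono_on, unfold mono_on_def, intro allI impI, elim conjE)
    fix s t assume "s \<in> {c..d}" "t \<in> {c..d}" "s \<le> t"
    then show "V s \<le> V t" using order_trans[OF norm_ge_zero V[of s t]] by simp
  qed
  have real_part: "h integrable_on {c..d}"
    if h: "\<And>s t. \<bar>h t - h s\<bar> \<le> cmod (g t - g s)" for h :: "real \<Rightarrow> real"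
  proof -
    have "(\<lambda>s. h s + V s) integrable_on {c..d}"
    proof (rule integrable_on_mono_on, unfold mono_on_def, intro allI impI, elim conjE)
      fix s t assume "s \<in> {c..d}" "t \<in> {c..d}" "s \<le> t"
      then show "h s + V s \<le> h t + V t" using V[of s t] h[of t s] by simp
    qed
    from integrable_diff[OF this V_int] show ?thesis by simp
  qed
  have "(\<lambda>s. Re (g s)) integrable_on {c..d}" "(\<lambda>s. Im (g s)) integrable_on {c..d}"
    using abs_Re_le_cmod[of "g t - g s" for t s] abs_Im_le_cmod[of "g t - g s" for t s]
    by (auto intro!: real_part)
  then show ?thesis
    using integrable_componentwise_iff[of g "{c..d}"] by (simp add: Basis_complex_def)
qed

text \<open>Near a point x the function \<open>w\<close> is almost constant, and g(s) times the
  fixed vector w(x) is integrable. Gluing such pieces gives uniform approximations by integrable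
  functions.\<close>

lemma integrable_scaleC_continuous:
  fixes g :: "real \<Rightarrow> complex" and w :: "real \<Rightarrow> 'a::complex_banach"
  assumes g: "g integrable_on {c..d}" and B: "\<And>s. s \<in> {c..d} \<Longrightarrow> cmod (g s) \<le> B"
    and w: "continuous_on {c..d} w"
  shows "(\<lambda>s. g s *\<^sub>C w s) integrable_on {c..d}"
proof (cases "c \<le> d")
  case cd: True
  have "0 \<le> B" using order_trans[OF norm_ge_zero B[of c]] cd by simp
  have "\<exists>h. (\<forall>s\<in>{c..d}. norm (g s *\<^sub>C w s - h s) \<le> e) \<and> h integrable_on {c..d}" if e: "0 < e" for e
  proof -
    \<comment> \<open>The guards make \<open>P\<close> vacuous outside [c,d]: the compactness
      argument \<open>Bolzano\<close> also asks for short intervals around x that leave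
      [c,d].\<close>
    define P where "P u v \<longleftrightarrow> (c \<le> u \<longrightarrow> v \<le> d \<longrightarrow>
      (\<exists>h. (\<forall>s\<in>{u..v}. norm (g s *\<^sub>C w s - h s) \<le> e) \<and> h integrable_on {u..v}))" for u v
    from cd have "P c d"
    proof (induction rule: Bolzano)
      case (trans x y z)
      show ?case
        unfolding P_def
      proof (intro impI)
        assume "c \<le> x" "z \<le> d"
        moreover have "c \<le> y" "y \<le> d" using trans(3,4) calculation by auto
        ultimately obtain h1 h2
          where h1: "\<forall>s\<in>{x..y}. norm (g s *\<^sub>C w s - h1 s) \<le> e" "h1 integrable_on {x..y}"
            and h2: "\<forall>s\<in>{y..z}. norm (g s *\<^sub>C w s - h2 s) \<le> e" "h2 integrable_on {y..z}"
          using trans(1)[unfolded P_def] trans(2)[unfolded P_def] by blast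
        define h where "h s = (if s \<le> y then h1 s else h2 s)" for s
        have "h integrable_on {x..y}"
          by (rule integrable_eq[OF h1(2)]) (simp add: h_def)
        moreover have "h integrable_on {y..z}"
          by (rule integrable_spike[OF h2(2) negligible_sing[of y]]) (auto simp: h_def)
        ultimately have "h integrable_on {x..z}"
          using trans by (intro Henstock_Kurzweil_Integration.integrable_combine[of x y z]) auto
        moreover have "\<forall>s\<in>{x..z}. norm (g s *\<^sub>C w s - h s) \<le> e"
          using h1(1) h2(1) by (auto simp: h_def)
        ultimately show "\<exists>h. (\<forall>s\<in>{x..z}. norm (g s *\<^sub>C w s - h s) \<le> e) \<and> h integrable_on {x..z}"
          by blast
      qed
    next
      case (local x)
      \<comment> \<open>The denominator is B + 1 because B may be 0.\<close>
      define e' where "e' = e / (B + 1)"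
      have e': "0 < e'" "B * e' \<le> e" using e \<open>0 \<le> B\<close> by (auto simp: e'_def pos_divide_le_eq)
      have "\<exists>\<delta>>0. \<forall>s\<in>{c..d}. dist s x < \<delta> \<longrightarrow> dist (w s) (w x) < e'"
        using local e'(1) by (intro w[unfolded continuous_on_iff, rule_format]) auto
      then obtain \<delta> where \<delta>: "\<delta> > 0" "\<And>s. s \<in> {c..d} \<Longrightarrow> dist s x < \<delta> \<Longrightarrow> norm (w s - w x) < e'"
        by (auto simp: dist_norm)
      show ?case
      proof (intro exI[of _ \<delta>] conjI \<delta>(1) allI impI, elim conjE)
        fix u v assume uv: "u \<le> x" "x \<le> v" "v - u < \<delta>"
        show "P u v"
          unfolding P_def
        proof (intro impI exI[of _ "\<lambda>s. g s *\<^sub>C w x"] conjI ballI)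
          assume cuv: "c \<le> u" "v \<le> d"
          have "g integrable_on {u..v}"
            using integrable_subinterval_real[OF g, of u v] cuv by auto
          from integrable_linear[OF this scaleC.bounded_linear_left[of "w x"]]
          show "(\<lambda>s. g s *\<^sub>C w x) integrable_on {u..v}" by (simp add: o_def)
          fix s assume s: "s \<in> {u..v}"
          then have "s \<in> {c..d}" "dist s x < \<delta>" using uv cuv by (auto simp: dist_real_def)
          then have "cmod (g s) * norm (w s - w x) \<le> B * e'"
            using \<delta>(2)[of s] B[of s] \<open>0 \<le> B\<close> by (intro mult_mono) auto
          then show "norm (g s *\<^sub>C w s - g s *\<^sub>C w x) \<le> e"
            using e'(2) by (simp add: scaleC.diff_right[symmetric] norm_scaleC)
        qed
      qed
    qed
    then show ?thesis by (simp add: P_def)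
  qed
  then show ?thesis
    unfolding cbox_interval[symmetric] by (rule integrable_uniform_limit)
qed auto

text \<open>Summation by parts against the tails \<open>\<integral>\<^sub>r\<^sup>d w\<close>, carried out infinitesimally: the error estimate
  \<open>P\<close> below is additive over adjacent intervals and holds on all short intervals.\<close>
lemma norm_integral_BV_le:
  fixes g :: "real \<Rightarrow> complex" and w :: "real \<Rightarrow> 'a::complex_banach"
  assumes cd: "c \<le> d"
    and V: "\<And>s t. c \<le> s \<Longrightarrow> s \<le> t \<Longrightarrow> t \<le> d \<Longrightarrow> cmod (g t - g s) \<le> V t - V s"
    and w: "continuous_on {c..d} w"
    and K: "\<And>r. r \<in> {c..d} \<Longrightarrow> norm (integral {r..d} w) \<le> K"
  shows "(\<lambda>s. g s *\<^sub>C w s) integrable_on {c..d}"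
    and "norm (integral {c..d} (\<lambda>s. g s *\<^sub>C w s)) \<le> K * (cmod (g c) + V d - V c)"
proof -
  have Vmono: "V s \<le> V t" if "c \<le> s" "s \<le> t" "t \<le> d" for s t
    using order_trans[OF norm_ge_zero V[OF that]] by simp
  have g_bdd: "cmod (g s) \<le> cmod (g c) + (V d - V c)" if "s \<in> {c..d}" for s
    using norm_triangle_ineq2[of "g s" "g c"] V[of c s] Vmono[of s d] that by auto
  show gw: "(\<lambda>s. g s *\<^sub>C w s) integrable_on {c..d}"
    by (rule integrable_scaleC_continuous[OF integrable_of_variation[OF V] g_bdd w]) auto
  have gw': "(\<lambda>s. g s *\<^sub>C w s) integrable_on {u..v}" if "c \<le> u" "v \<le> d" for u v
    using integrable_subinterval_real[OF gw, of u v] that by auto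
  have w': "w integrable_on {u..v}" if "c \<le> u" "v \<le> d" for u v
    using integrable_subinterval_real[OF integrable_continuous_real[OF w], of u v] that by auto
  have "compact (w ` {c..d})" using w by (intro compact_continuous_image) auto
  then obtain W where W: "\<And>u. u \<in> {c..d} \<Longrightarrow> norm (w u) \<le> W" "0 < W"
    by (metis bounded_pos compact_imp_bounded imageI)
  define U where "U r = integral {r..d} w" for r
  \<comment> \<open>The slack e absorbs the error of freezing \<open>g\<close> on a short interval,
    a product of variation and length; letting e tend to 0 removes it.\<close>
  have bound: "norm (integral {c..d} (\<lambda>s. g s *\<^sub>C w s) - g c *\<^sub>C U c) \<le> (K + e) * (V d - V c)"
    if e: "0 < e" for e
  proof -
    define P where "P u v \<longleftrightarrow> (c \<le> u \<longrightarrow> v \<le> d \<longrightarrow>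
      norm (integral {u..v} (\<lambda>s. g s *\<^sub>C w s) - (g u *\<^sub>C U u - g v *\<^sub>C U v)) \<le> (K + e) * (V v - V u))" for u v
    from cd have "P c d"
    proof (induction rule: Bolzano)
      case (trans x y z)
      show ?case
        unfolding P_def
      proof (intro impI)
        assume xz: "c \<le> x" "z \<le> d"
        let ?A = "\<lambda>u v. integral {u..v} (\<lambda>s. g s *\<^sub>C w s) - (g u *\<^sub>C U u - g v *\<^sub>C U v)"
        have "integral {x..y} (\<lambda>s. g s *\<^sub>C w s) + integral {y..z} (\<lambda>s. g s *\<^sub>C w s) = integral {x..z} (\<lambda>s. g s *\<^sub>C w s)"
          using trans xz by (intro Henstock_Kurzweil_Integration.integral_combine gw') auto
        then have "?A x z = ?A x y + ?A y z" by (simp add: algebra_simps)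
        also have "norm \<dots> \<le> (K + e) * (V y - V x) + (K + e) * (V z - V y)"
          using trans xz unfolding P_def by (intro norm_triangle_mono) auto
        finally show "norm (?A x z) \<le> (K + e) * (V z - V x)" by (simp add: algebra_simps)
      qed
    next
      case (local x)
      show ?case
      proof (intro exI[of _ "e / W"] conjI allI impI)
        \<comment> \<open>On an interval shorter than e/W the freezing error, variation times W
          times length, is at most e times the variation.\<close>
        show "0 < e / W" using e W(2) by simp
        fix u v assume "u \<le> x \<and> x \<le> v \<and> v - u < e / W"
        then have uv: "u \<le> x" "x \<le> v" "v - u < e / W" by auto
        show "P u v"
          unfolding P_def
        proof (intro impI)
          assume cuv: "c \<le> u" "v \<le> d"
          have "integral {u..v} w + integral {v..d} w = integral {u..d} w"
            using uv cuv by (intro Henstock_Kurzweil_Integration.integral_combine w') auto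
          then have Ud: "U u - U v = integral {u..v} w" by (simp add: U_def algebra_simps)
          have cw: "(\<lambda>s. g u *\<^sub>C w s) integrable_on {u..v}"
            using integrable_linear[OF w'[OF cuv] scaleC.bounded_linear_right[of "g u"]] by (simp add: o_def)
          \<comment> \<open>Freezing \<open>g\<close> at the left end u leaves two errors: the
            oscillation of \<open>g\<close> against \<open>w\<close> inside the interval, and the
            jump of \<open>g\<close> against the tail \<open>U v\<close>, which is bounded by
            K.\<close>
          have "integral {u..v} (\<lambda>s. g s *\<^sub>C w s) - (g u *\<^sub>C U u - g v *\<^sub>C U v)
              = (integral {u..v} (\<lambda>s. g s *\<^sub>C w s) - g u *\<^sub>C (U u - U v)) + (g v - g u) *\<^sub>C U v"
            by (simp add: scaleC.diff_left scaleC.diff_right algebra_simps)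
          also have "integral {u..v} (\<lambda>s. g s *\<^sub>C w s) - g u *\<^sub>C (U u - U v)
              = integral {u..v} (\<lambda>s. (g s - g u) *\<^sub>C w s)"
            by (simp add: Ud integral_scaleC_right[OF w'[OF cuv], symmetric] scaleC.diff_left
                integral_diff[OF gw'[OF cuv] cw])
          also have "norm (\<dots> + (g v - g u) *\<^sub>C U v) \<le> (V v - V u) * W * (v - u) + (V v - V u) * K"
          proof (rule norm_triangle_mono)
            show "norm (integral {u..v} (\<lambda>s. (g s - g u) *\<^sub>C w s)) \<le> (V v - V u) * W * (v - u)"
            proof (rule integral_norm_bound_const)
              show "(\<lambda>s. (g s - g u) *\<^sub>C w s) integrable_on {u..v}"
                using integrable_diff[OF gw'[OF cuv] cw] by (simp add: scaleC.diff_left)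
              fix s assume s: "s \<in> {u..v}"
              then have "cmod (g s - g u) \<le> V v - V u"
                using V[of u s] Vmono[of s v] uv cuv by auto
              then show "norm ((g s - g u) *\<^sub>C w s) \<le> (V v - V u) * W"
                unfolding norm_scaleC using W s cuv Vmono[of u v] uv by (intro mult_mono) auto
            qed (use uv in simp)
            show "norm ((g v - g u) *\<^sub>C U v) \<le> (V v - V u) * K"
              unfolding norm_scaleC U_def using V[of u v] K[of v] Vmono[of u v] uv cuv
              by (intro mult_mono) auto
          qed
          also have "\<dots> = (V v - V u) * (W * (v - u) + K)" by (simp add: algebra_simps)
          also have "\<dots> \<le> (V v - V u) * (e + K)"
            using uv(3) W(2) Vmono[of u v] uv cuv
            by (intro mult_left_mono add_right_mono) (auto simp: pos_less_divide_eq mult.commute)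
          finally show "norm (integral {u..v} (\<lambda>s. g s *\<^sub>C w s) - (g u *\<^sub>C U u - g v *\<^sub>C U v)) \<le> (K + e) * (V v - V u)"
            by (simp add: mult.commute add.commute)
        qed
      qed
    qed
    \<comment> \<open>The boundary term at d disappears because the tail \<open>U d\<close> is
      0.\<close>
    then show ?thesis by (simp add: P_def U_def scaleC.zero_right)
  qed
  have "norm (integral {c..d} (\<lambda>s. g s *\<^sub>C w s) - g c *\<^sub>C U c) \<le> K * (V d - V c)"
  proof (rule tendsto_lowerbound)
    show "((\<lambda>e. (K + e) * (V d - V c)) \<longlongrightarrow> K * (V d - V c)) (at_right 0)"
      by (rule tendsto_eq_intros refl)+ simp
    show "\<forall>\<^sub>F e in at_right 0. norm (integral {c..d} (\<lambda>s. g s *\<^sub>C w s) - g c *\<^sub>C U c) \<le> (K + e) * (V d - V c)"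
      using eventually_at_right_less[of "0::real"] by (rule eventually_mono) (rule bound)
  qed simp
  moreover have "norm (g c *\<^sub>C U c) \<le> K * cmod (g c)"
    unfolding norm_scaleC U_def using mult_left_mono[OF K[of c] norm_ge_zero[of "g c"]] cd by (simp add: mult.commute)
  moreover have "norm (integral {c..d} (\<lambda>s. g s *\<^sub>C w s)) \<le>
      norm (integral {c..d} (\<lambda>s. g s *\<^sub>C w s) - g c *\<^sub>C U c) + norm (g c *\<^sub>C U c)"
    by (metis diff_add_cancel norm_triangle_ineq)
  ultimately show "norm (integral {c..d} (\<lambda>s. g s *\<^sub>C w s)) \<le> K * (cmod (g c) + V d - V c)"
    by (simp add: algebra_simps)
qed

section \<open>Convergence\<close>

lemma tendsto_at_right_0_Cauchy:
  fixes f :: "real \<Rightarrow> 'b::banach"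
  assumes "\<And>e. 0 < e \<Longrightarrow> \<exists>\<delta>>0. \<forall>s t. 0 < s \<longrightarrow> s < \<delta> \<longrightarrow> 0 < t \<longrightarrow> t < \<delta> \<longrightarrow> norm (f s - f t) < e"
  shows "\<exists>y. (f \<longlongrightarrow> y) (at_right 0)"
proof -
  define X where "X n = f (1 / real (Suc n))" for n
  have tends: "(\<lambda>n. 1 / real (Suc n)) \<longlonglongrightarrow> 0"
    using LIMSEQ_inverse_real_of_nat by (simp add: inverse_eq_divide)
  have small: "\<exists>n. \<forall>m\<ge>n. 1 / real (Suc m) < \<delta>" if "0 < \<delta>" for \<delta>
    using order_tendstoD(2)[OF tends that] by (simp add: eventually_sequentially)
  have "Cauchy X"
  proof (rule metric_CauchyI)
    fix e :: real assume "0 < e"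
    then obtain \<delta> where \<delta>: "0 < \<delta>" "\<And>s t. 0 < s \<Longrightarrow> s < \<delta> \<Longrightarrow> 0 < t \<Longrightarrow> t < \<delta> \<Longrightarrow> norm (f s - f t) < e"
      using assms by meson
    obtain n where n: "\<And>m. n \<le> m \<Longrightarrow> 1 / real (Suc m) < \<delta>" using small[OF \<delta>(1)] by auto
    show "\<exists>M. \<forall>m\<ge>M. \<forall>n\<ge>M. dist (X m) (X n) < e"
      unfolding X_def dist_norm by (intro exI[of _ n] allI impI \<delta>(2) n) auto
  qed
  then obtain y where y: "X \<longlonglongrightarrow> y" using Cauchy_convergent convergent_def by blast
  have "(f \<longlongrightarrow> y) (at_right 0)"
  proof (rule tendstoI)
    fix e :: real assume "0 < e"
    then obtain \<delta> where \<delta>: "0 < \<delta>" "\<And>s t. 0 < s \<Longrightarrow> s < \<delta> \<Longrightarrow> 0 < t \<Longrightarrow> t < \<delta> \<Longrightarrow> norm (f s - f t) < e / 2"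
      using assms[of "e / 2"] by auto
    obtain n where n: "\<And>m. n \<le> m \<Longrightarrow> 1 / real (Suc m) < \<delta>" using small[OF \<delta>(1)] by auto
    obtain k where k: "\<And>m. k \<le> m \<Longrightarrow> dist (X m) y < e / 2"
      using tendstoD[OF y, of "e / 2"] \<open>0 < e\<close> by (auto simp: eventually_sequentially)
    have "dist (f s) y < e" if "0 < s" "s < \<delta>" for s
    proof -
      have "dist (f s) (X (max n k)) < e / 2"
        unfolding X_def dist_norm using that n[of "max n k"] by (intro \<delta>(2)) auto
      then show ?thesis using k[of "max n k"] dist_triangle_half_r[of "X (max n k)" "f s" e y]
        by (simp add: dist_commute)
    qed
    then show "\<forall>\<^sub>F s in at_right 0. dist (f s) y < e"
      using \<delta>(1) by (auto simp: eventually_at_right)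
  qed
  then show ?thesis by blast
qed

text \<open>Orbits of the averages \<open>1/h \<integral>\<^sub>0\<^sup>h T(s) z ds\<close> are Lipschitz, so for such vectors the principal value
  integrand is bounded.\<close>
lemma C0_semigroup_lipschitz_dense:
  fixes T :: "real \<Rightarrow> 'a::complex_banach \<Rightarrow> 'a"
  assumes T: "C0_semigroup T" and ab: "0 < a" "a \<le> b" and e: "0 < e"
  shows "\<exists>x' L. norm (x' - x) < e \<and>
    (\<forall>v\<in>{0..a}. norm (T (b + v) x' - T (b - v) x') \<le> L * v)"
proof -
  note cont = C0_semigroupD(4)[OF T]
  have "\<exists>\<delta>>0. \<forall>s\<in>{0..}. dist s 0 < \<delta> \<longrightarrow> dist (T s x) (T 0 x) < e / 2"
    using cont[of x, unfolded continuous_on_iff, rule_format, of 0 "e / 2"] e by auto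
  then obtain \<delta> where \<delta>: "0 < \<delta>" "\<And>s. 0 \<le> s \<Longrightarrow> s < \<delta> \<Longrightarrow> norm (T s x - x) < e / 2"
    by (auto simp: dist_norm C0_semigroupD(2)[OF T])
  define h where "h = \<delta> / 2"
  have h: "0 < h" "h < \<delta>" using \<delta>(1) by (auto simp: h_def)
  have int: "(\<lambda>s. T s x) integrable_on {u..v}" if "0 \<le> u" for u v
    by (intro integrable_continuous_real continuous_on_subset[OF cont]) (use that in auto)
  define y where "y = integral {0..h} (\<lambda>s. T s x)"
  define x' where "x' = (1 / h) *\<^sub>R y"
  have "norm (x' - x) < e"
  proof -
    have "h *\<^sub>R (x' - x) = integral {0..h} (\<lambda>s. T s x - x)"
      using h integral_diff[OF int[OF order_refl] integrable_const_ivl]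
      by (simp add: x'_def y_def scaleR_diff_right)
    also have "norm \<dots> \<le> e / 2 * (h - 0)"
      using h \<delta>(2) by (intro integral_norm_bound_const integrable_diff int order_refl less_imp_le) auto
    finally have "h * norm (x' - x) \<le> h * (e / 2)" using h by (simp add: mult.commute)
    then have "norm (x' - x) \<le> e / 2" using h by simp
    then show ?thesis using e by linarith
  qed
  moreover
  have "compact ((\<lambda>s. T s x) ` {0..h + 2 * a})"
    by (intro compact_continuous_image continuous_on_subset[OF cont]) auto
  then obtain B where B: "0 < B" "\<And>s. s \<in> {0..h + 2 * a} \<Longrightarrow> norm (T s x) \<le> B"
    by (metis bounded_pos compact_imp_bounded imageI)
  obtain M where M: "1 \<le> M" "\<And>s z. s \<in> {0..b} \<Longrightarrow> norm (T s z) \<le> M * norm z"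
    using C0_semigroup_locally_bounded[OF T, of b] by auto
  have "norm (T (b + v) x' - T (b - v) x') \<le> (M * (4 * B) / h) * v" if v: "v \<in> {0..a}" for v
  proof -
    interpret Tv: bounded_linear "T (2 * v)" using v by (intro C0_semigroupD(1)[OF T]) auto
    interpret Tb: bounded_linear "T (b - v)" using v ab by (intro C0_semigroupD(1)[OF T]) auto
    have "T (2 * v) y = integral {0..h} (\<lambda>s. T (2 * v) (T s x))"
      unfolding y_def using integral_linear[OF int[of 0 h] Tv.bounded_linear_axioms] by (simp add: o_def)
    also have "\<dots> = integral {0..h} ((\<lambda>s. T s x) \<circ> ((+) (2 * v)))"
      using v by (intro integral_cong) (simp add: C0_semigroupD(3)[OF T])
    also have "\<dots> = integral {2 * v..h + 2 * v} (\<lambda>s. T s x)"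
      by (simp add: integral_shift_Icc_real)
    finally have Ty: "T (2 * v) y = integral {2 * v..h + 2 * v} (\<lambda>s. T s x)" .
    \<comment> \<open>[0, h + 2v] is cut in two ways. Subtracting, T(2v)y - y becomes a difference
      of integrals over two intervals of length 2v, hence is linear in v.\<close>
    have "integral {0..2 * v} (\<lambda>s. T s x) + integral {2 * v..h + 2 * v} (\<lambda>s. T s x)
        = integral {0..h + 2 * v} (\<lambda>s. T s x)"
      using v h by (intro Henstock_Kurzweil_Integration.integral_combine int) auto
    moreover have "integral {0..h} (\<lambda>s. T s x) + integral {h..h + 2 * v} (\<lambda>s. T s x)
        = integral {0..h + 2 * v} (\<lambda>s. T s x)"
      using v h by (intro Henstock_Kurzweil_Integration.integral_combine int) auto
    ultimately have "T (2 * v) y - y = integral {h..h + 2 * v} (\<lambda>s. T s x) - integral {0..2 * v} (\<lambda>s. T s x)"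
      unfolding Ty unfolding y_def by (simp add: algebra_simps)
    moreover have "norm (integral {h..h + 2 * v} (\<lambda>s. T s x)) \<le> B * (h + 2 * v - h)"
      using v h by (intro integral_norm_bound_const int B(2)) auto
    moreover have "norm (integral {0..2 * v} (\<lambda>s. T s x)) \<le> B * (2 * v - 0)"
      using v h by (intro integral_norm_bound_const int B(2)) auto
    ultimately have "norm (T (2 * v) y - y) \<le> B * (h + 2 * v - h) + B * (2 * v - 0)"
      by (simp only:) (rule order_trans[OF norm_triangle_ineq4 add_mono])
    then have y_le: "norm (T (2 * v) y - y) \<le> 4 * B * v" by simp
    \<comment> \<open>The difference of the two orbit values is T(b - v) applied to (T(2v) -
      1)x'.\<close>
    have "T (b + v) x' = T (b - v) (T (2 * v) x')"
      using C0_semigroupD(3)[OF T, of "b - v" "2 * v" x'] v ab by (simp add: add.commute)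
    then have "T (b + v) x' - T (b - v) x' = T (b - v) ((1 / h) *\<^sub>R (T (2 * v) y - y))"
      by (simp only: Tb.diff[symmetric] x'_def Tv.scaleR scaleR_diff_right)
    also have "norm \<dots> \<le> M * norm ((1 / h) *\<^sub>R (T (2 * v) y - y))"
      using v ab by (intro M(2)) auto
    also have "\<dots> = M / h * norm (T (2 * v) y - y)" using h by simp
    also have "\<dots> \<le> M / h * (4 * B * v)"
      using M(1) h by (intro mult_left_mono y_le) auto
    finally show ?thesis by simp
  qed
  ultimately show ?thesis by blast
qed

text \<open>\<open>integral\<close> is 0 for a function that is not integrable, so the first
  conjunct is what gives the limit its meaning: for 0 < \<epsilon> \<le> 1 the truncated integrals
  really exist.\<close>

theorem theorem7p1:
  fixes T :: "real \<Rightarrow> 'a::complex_banach \<Rightarrow> 'a"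
    and g :: "real \<Rightarrow> complex"
    and a b :: real
    and x :: 'a
  assumes "UMD TYPE('a)"
    and "C0_semigroup T"
    and "0 < a" and "a < b"
    and "BV_on (b - a) (b + a) g"
    and "\<And>t. \<bar>t\<bar> \<le> a \<Longrightarrow> g (b - t) = g (b + t)"
  shows "(\<forall>\<epsilon>\<in>{0<..1}. (\<lambda>s. (g s / complex_of_real (s - b)) *\<^sub>C T s x)
            integrable_on {s. \<epsilon> * a \<le> \<bar>s - b\<bar> \<and> \<bar>s - b\<bar> \<le> a}) \<and>
         (\<exists>y. ((\<lambda>\<epsilon>. integral {s. \<epsilon> * a \<le> \<bar>s - b\<bar> \<and> \<bar>s - b\<bar> \<le> a}
                  (\<lambda>s. (g s / complex_of_real (s - b)) *\<^sub>C T s x)) \<longlongrightarrow> y) (at_right 0))"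
proof -
  note umd = assms(1) and T = assms(2) and a = assms(3) and b = assms(4)
    and bv = assms(5) and even = assms(6)
  \<comment> \<open>The annulus is folded at b onto [r,a] with r = \<epsilon> a. By evenness both
    halves carry the weight \<open>G v\<close>, and 1/(s - b) equals 1/v and -1/v on them, so the
    folded integrand is \<open>G v\<close> times \<open>w x v\<close>. The vector z is kept variable
    for the density argument.\<close>
  define w where "w z v = (1 / v) *\<^sub>R (T (b + v) z - T (b - v) z)" for z v
  define G where "G v = g (b + v)" for v
  define I where "I r z = integral {r..a} (\<lambda>v. G v *\<^sub>C w z v)" for r z
  obtain V where V: "\<And>s t. b - a \<le> s \<Longrightarrow> s \<le> t \<Longrightarrow> t \<le> b + a \<Longrightarrow> cmod (g t - g s) \<le> V t - V s"
    using BV_on_variation[OF bv] by auto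
  have GV: "cmod (G t - G s) \<le> V (b + t) - V (b + s)" if "0 \<le> s" "s \<le> t" "t \<le> a" for s t
    unfolding G_def using that a by (intro V) auto
  have Vmono: "V (b + s) \<le> V (b + t)" if "0 \<le> s" "s \<le> t" "t \<le> a" for s t
    using order_trans[OF norm_ge_zero GV[OF that]] by simp
  \<comment> \<open>Dominates, for every r at once, the initial value plus the variation of
    \<open>G\<close> on [r,a], the factor that summation by parts produces; it also dominates
    |G|.\<close>
  define C where "C = cmod (G 0) + V (b + a) - V b"
  have G_le: "cmod (G r) + V (b + a) - V (b + r) \<le> C" if "r \<in> {0..a}" for r
    using norm_triangle_ineq2[of "G r" "G 0"] GV[of 0 r] that by (simp add: C_def)
  have C: "0 \<le> C" "\<And>r. r \<in> {0..a} \<Longrightarrow> cmod (G r) \<le> C"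
  proof -
    show "cmod (G r) \<le> C" if "r \<in> {0..a}" for r
      using G_le[OF that] Vmono[of r a] that by simp
    from this[of 0] show "0 \<le> C" using a order_trans[OF norm_ge_zero] by auto
  qed
  have orbit: "continuous_on {r..a} (\<lambda>v. T (b + v) z)" "continuous_on {r..a} (\<lambda>v. T (b - v) z)"
    if "0 \<le> r" for r z
    by (rule continuous_on_compose2[OF C0_semigroupD(4)[OF T, of z], where f = "\<lambda>v. b + v"]
        continuous_on_compose2[OF C0_semigroupD(4)[OF T, of z], where f = "\<lambda>v. b - v"];
        use that a b in \<open>auto intro!: continuous_intros\<close>)+
  have w_cont: "continuous_on {r..a} (w z)" if "0 < r" for r z
    unfolding w_def[abs_def] using that
    by (intro continuous_on_scaleR continuous_on_diff orbit) (auto intro!: continuous_intros)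
  obtain K where K: "0 \<le> K" "\<And>r z. 0 < r \<Longrightarrow> r \<le> a \<Longrightarrow> norm (integral {r..a} (w z)) \<le> K * norm z"
    unfolding w_def[abs_def] using truncated_semigroup_bound[OF umd T a b] by blast
  have I_int: "(\<lambda>v. G v *\<^sub>C w z v) integrable_on {r..a}"
    and I_le: "norm (I r z) \<le> K * C * norm z" if r: "0 < r" "r \<le> a" for r z
  proof -
    have V': "cmod (G t - G s) \<le> V (b + t) - V (b + s)" if "r \<le> s" "s \<le> t" "t \<le> a" for s t
      using that r by (intro GV) auto
    \<comment> \<open>The tails required by summation by parts are the unweighted truncated
      integrals from s to a, exactly what transference bounds.\<close>
    have K': "norm (integral {s..a} (w z)) \<le> K * norm z" if "s \<in> {r..a}" for s
      using that r by (intro K) auto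
    note bound = norm_integral_BV_le[OF r(2) V' w_cont[OF r(1)] K']
    show "(\<lambda>v. G v *\<^sub>C w z v) integrable_on {r..a}" by (rule bound(1))
    have "norm (I r z) \<le> K * norm z * (cmod (G r) + V (b + a) - V (b + r))"
      unfolding I_def by (rule bound(2))
    also have "\<dots> \<le> K * norm z * C"
      using K(1) r by (intro mult_left_mono G_le) auto
    finally show "norm (I r z) \<le> K * C * norm z" by (simp add: mult_ac)
  qed
  have I_diff: "I r y - I r z = I r (y - z)" if r: "0 < r" "r \<le> a" for r y z
  proof -
    have "w (y - z) v = w y v - w z v" if "v \<in> {r..a}" for v
    proof -
      interpret p: bounded_linear "T (b + v)" using that r b by (intro C0_semigroupD(1)[OF T]) auto
      interpret m: bounded_linear "T (b - v)" using that r b by (intro C0_semigroupD(1)[OF T]) auto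
      show ?thesis by (simp add: w_def p.diff m.diff algebra_simps)
    qed
    then have "I r (y - z) = integral {r..a} (\<lambda>v. G v *\<^sub>C w y v - G v *\<^sub>C w z v)"
      unfolding I_def by (intro integral_cong) (simp add: scaleC.diff_right)
    then show ?thesis unfolding I_def by (simp add: integral_diff I_int r)
  qed
  have annulus: "((\<lambda>s. (g s / complex_of_real (s - b)) *\<^sub>C T s x) has_integral I r x)
      {s. r \<le> \<bar>s - b\<bar> \<and> \<bar>s - b\<bar> \<le> a}" if r: "0 < r" "r \<le> a" for r
  proof -
    let ?f = "\<lambda>s. (g s / complex_of_real (s - b)) *\<^sub>C T s x"
    have G_int: "G integrable_on {r..a}"
      using r by (intro integrable_of_variation[where V = "\<lambda>v. V (b + v)"] GV) auto
    have part: "(\<lambda>v. G v *\<^sub>C ((1 / v) *\<^sub>R T (f v) x)) integrable_on {r..a}"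
      if "continuous_on {r..a} (\<lambda>v. T (f v) x)" for f
      using r that by (intro integrable_scaleC_continuous[OF G_int C(2)] continuous_on_scaleR)
        (auto intro!: continuous_intros)
    have plus_eq: "?f (b + v) = G v *\<^sub>C ((1 / v) *\<^sub>R T (b + v) x)" for v
      by (simp add: G_def scaleC_of_real[symmetric] scaleC_scaleC)
    have minus_eq: "?f (b - v) = - (G v *\<^sub>C ((1 / v) *\<^sub>R T (b - v) x))" if "v \<in> {r..a}" for v
      using even[of v] that r
      by (simp add: G_def scaleC_of_real[symmetric] scaleC_scaleC scaleC.minus_left[symmetric])
    have "(?f has_integral integral {r..a} (\<lambda>v. ?f (b + v) + ?f (b - v))) {s. r \<le> \<bar>s - b\<bar> \<and> \<bar>s - b\<bar> \<le> a}"
    proof (rule has_integral_symmetric_annulus[OF r(1)])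
      show "(\<lambda>v. ?f (b + v)) integrable_on {r..a}"
        unfolding plus_eq using r by (intro part orbit) auto
      show "(\<lambda>v. ?f (b - v)) integrable_on {r..a}"
      proof (rule integrable_eq)
        show "(\<lambda>v. - (G v *\<^sub>C ((1 / v) *\<^sub>R T (b - v) x))) integrable_on {r..a}"
          using r by (intro integrable_neg part orbit) auto
      qed (rule minus_eq[symmetric])
    qed
    also have "integral {r..a} (\<lambda>v. ?f (b + v) + ?f (b - v)) = I r x"
      unfolding I_def
    proof (rule integral_cong)
      fix v assume v: "v \<in> {r..a}"
      show "?f (b + v) + ?f (b - v) = G v *\<^sub>C w x v"
        unfolding plus_eq minus_eq[OF v] w_def by (simp add: scaleR_diff_right scaleC.diff_right)
    qed
    finally show ?thesis .
  qed
  have "\<exists>\<delta>>0. \<forall>s t. 0 < s \<longrightarrow> s < \<delta> \<longrightarrow> 0 < t \<longrightarrow> t < \<delta> \<longrightarrow> norm (I (s * a) x - I (t * a) x) < e"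
    if e: "0 < e" for e
  proof -
    \<comment> \<open>Chosen so that replacing x by a vector with Lipschitz orbit changes each
      truncated integral by at most e/4, uniformly in r; the added 1 covers K C = 0.\<close>
    define \<eta> where "\<eta> = e / 4 / (K * C + 1)"
    have KC: "0 \<le> K * C" using K(1) C(1) by simp
    then have \<eta>: "0 < \<eta>" "K * C * \<eta> \<le> e / 4"
    proof -
      show "0 < \<eta>" using KC e by (simp add: \<eta>_def)
      then have "K * C * \<eta> \<le> (K * C + 1) * \<eta>" by (intro mult_right_mono) auto
      also have "\<dots> = e / 4" unfolding \<eta>_def
        by (rule nonzero_mult_div_cancel_left[of "K * C + 1" "e / 4", unfolded times_divide_eq_right[symmetric]])
          (use KC in linarith)
      finally show "K * C * \<eta> \<le> e / 4" .
    qed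
    obtain x' L where x': "norm (x' - x) < \<eta>"
      and L: "\<And>v. v \<in> {0..a} \<Longrightarrow> norm (T (b + v) x' - T (b - v) x') \<le> L * v"
      using C0_semigroup_lipschitz_dense[OF T a less_imp_le[OF b] \<eta>(1)] by metis
    have near: "norm (I r x - I r x') \<le> e / 4" if "0 < r" "r \<le> a" for r
    proof -
      have "norm (I r x - I r x') \<le> K * C * norm (x - x')"
        using I_le[OF that] by (simp add: I_diff[OF that])
      also have "\<dots> \<le> K * C * \<eta>"
        using x' KC by (intro mult_left_mono) (auto simp: norm_minus_commute)
      finally show ?thesis using \<eta>(2) by linarith
    qed
    have L0: "0 \<le> L"
      using order_trans[OF norm_ge_zero L[of a]] a by (simp add: zero_le_mult_iff)
    \<comment> \<open>The Lipschitz estimate cancels the factor 1/v, so the integrand stays below C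
      L and thin annuli contribute little.\<close>
    have tail: "norm (I r x' - I r' x') \<le> C * L * (r' - r)" if r: "0 < r" "r \<le> r'" "r' \<le> a" for r r'
    proof -
      have "integral {r..r'} (\<lambda>v. G v *\<^sub>C w x' v) + I r' x' = I r x'"
        unfolding I_def using r by (intro Henstock_Kurzweil_Integration.integral_combine I_int) auto
      then have "I r x' - I r' x' = integral {r..r'} (\<lambda>v. G v *\<^sub>C w x' v)"
        by (simp add: algebra_simps)
      also have "norm \<dots> \<le> C * L * (r' - r)"
      proof (rule integral_norm_bound_const[OF _ r(2)])
        show "(\<lambda>v. G v *\<^sub>C w x' v) integrable_on {r..r'}"
          using integrable_subinterval_real[OF I_int[of r x'], of r r'] r by auto
        fix v assume v: "v \<in> {r..r'}"
        then have "norm (w x' v) \<le> L"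
          using L[of v] r by (simp add: w_def pos_divide_le_eq)
        then show "norm (G v *\<^sub>C w x' v) \<le> C * L"
          unfolding norm_scaleC using C v r by (intro mult_mono) auto
      qed
      finally show ?thesis .
    qed
    \<comment> \<open>The bound 1 keeps t a inside (0,a]; the other term makes the contribution of
      the Lipschitz vector at most e/4.\<close>
    define \<delta> where "\<delta> = min 1 (e / 4 / (C * L * a + 1))"
    have CLa: "0 \<le> C * L * a" using C(1) L0 a by simp
    have \<delta>: "0 < \<delta>" "\<delta> \<le> 1" using e CLa by (auto simp: \<delta>_def)
    have "C * L * a * \<delta> \<le> (C * L * a + 1) * (e / 4 / (C * L * a + 1))"
      using CLa \<delta> by (intro mult_mono) (auto simp: \<delta>_def)
    also have "\<dots> = e / 4"
      by (rule nonzero_mult_div_cancel_left[of "C * L * a + 1" "e / 4", unfolded times_divide_eq_right[symmetric]])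
        (use CLa in linarith)
    finally have \<delta>_small: "C * L * a * \<delta> \<le> e / 4" .
    have ordered: "norm (I (s * a) x - I (t * a) x) < e" if st: "0 < s" "s \<le> t" "t < \<delta>" for s t
    proof -
      have sa: "0 < s * a" "s * a \<le> t * a" "t * a \<le> a"
        using st a \<delta>(2) by (auto simp: mult_left_le_one_le)
      have "norm (I (s * a) x' - I (t * a) x') \<le> C * L * (t * a - s * a)" by (rule tail[OF sa])
      also have "\<dots> = C * L * a * (t - s)" by (simp add: algebra_simps)
      also have "\<dots> \<le> C * L * a * \<delta>" using CLa st by (intro mult_left_mono) auto
      finally have mid: "norm (I (s * a) x' - I (t * a) x') \<le> e / 4" using \<delta>_small by linarith
      \<comment> \<open>Three errors of e/4: passing to x' at radius s a, the annulus between the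
        radii for x', and passing back to x at radius t a.\<close>
      have "norm (I (s * a) x - I (s * a) x' + (I (s * a) x' - I (t * a) x') - (I (t * a) x - I (t * a) x'))
          \<le> e / 4 + e / 4 + e / 4"
        by (rule order_trans[OF norm_triangle_ineq4 add_mono[OF norm_triangle_mono[OF
                near[OF sa(1) order_trans[OF sa(2,3)]] mid] near[OF less_le_trans[OF sa(1,2)] sa(3)]]])
      then have "norm (I (s * a) x - I (t * a) x) \<le> e / 4 + e / 4 + e / 4" by simp
      then show ?thesis using e by linarith
    qed
    have "norm (I (s * a) x - I (t * a) x) < e" if "0 < s" "s < \<delta>" "0 < t" "t < \<delta>" for s t
      using ordered[of s t] ordered[of t s] that norm_minus_commute[of "I (s * a) x" "I (t * a) x"]
      by (cases "s \<le> t") auto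
    then show ?thesis using \<delta>(1) by blast
  qed
  then obtain y where y: "((\<lambda>\<epsilon>. I (\<epsilon> * a) x) \<longlongrightarrow> y) (at_right 0)"
    using tendsto_at_right_0_Cauchy[of "\<lambda>\<epsilon>. I (\<epsilon> * a) x"] by blast
  have "((\<lambda>\<epsilon>. integral {s. \<epsilon> * a \<le> \<bar>s - b\<bar> \<and> \<bar>s - b\<bar> \<le> a}
      (\<lambda>s. (g s / complex_of_real (s - b)) *\<^sub>C T s x)) \<longlongrightarrow> y) (at_right 0)"
  proof (rule Lim_transform_eventually[OF y])
    have "\<forall>\<^sub>F \<epsilon> in at_right 0. \<epsilon> \<in> {0<..<1::real}"
      by (rule eventually_at_right_real) simp
    then show "\<forall>\<^sub>F \<epsilon> in at_right 0. I (\<epsilon> * a) x = integral {s. \<epsilon> * a \<le> \<bar>s - b\<bar> \<and> \<bar>s - b\<bar> \<le> a}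
        (\<lambda>s. (g s / complex_of_real (s - b)) *\<^sub>C T s x)"
    proof eventually_elim
      case (elim \<epsilon>)
      then show ?case
        using integral_unique[OF annulus[of "\<epsilon> * a"]] a by (simp add: mult_left_le_one_le)
    qed
  qed
  moreover have "(\<lambda>s. (g s / complex_of_real (s - b)) *\<^sub>C T s x)
      integrable_on {s. \<epsilon> * a \<le> \<bar>s - b\<bar> \<and> \<bar>s - b\<bar> \<le> a}" if "\<epsilon> \<in> {0<..1}" for \<epsilon>
    using has_integral_integrable[OF annulus[of "\<epsilon> * a"]] that a by (simp add: mult_left_le_one_le)
  ultimately show ?thesis by blast
qed

end
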